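(* The sampling limit of a convergent sequence of nontrivial finite trees is unique up to isomorphism: if $(T_n)_{n\in\mathbb{N}}$ is a sequence of nontrivial finite trees and $D,D'$ are dendrons such that $\tau_r(T_n)$ converges weakly both to $\tau_r(D)$ and to $\tau_r(D')$ for all $r\ge1$, then $D$ and $D'$ are isomorphic. More generally, if two long dendrons $D$ and $D'$ satisfy $\tau_r(D)=\tau_r(D')$ for all $r\ge1$, then $D$ and $D'$ are isomorphic.
   Context: $\mathbb{N}$ is the set of positive integers. A finite (graph-theoretic) tree is identified with its vertex set and is nontrivial if it has at least two vertices. For a nontrivial finite tree $T$ with shortest path metric $\overline{d}_T$, the normalized distance is $d_T(x,y)=\overline{d}_T(x,y)/\mathrm{diam}_{\overline{d}_T}(T)$, and $\mu_T$ is the uniform probability measure on $T$. Sampling measures. For $r\ge1$, $M_r$ is the space of real $r\times r$ matrices, identified with $\prod_{1\le i,j\le r}\mathbb{R}$; $\mathrm{Prob}(M_r)$ is the space of Borel probability measures on $M_r$. For a set $X$ and $d:X^2\to\mathbb{R}$, define $\rho_r^{X,d}:X^r\to M_r$ by $\rho_r^{X,d}(x_1,\dots,x_r)=(d_{ij})$, with $d_{ij}=d(x_i,x_j)$ for $i\ne j$ and $d_{ii}=0$. For a triple $(X,d,\mu)$ with $\mu$ a probability measure on $X$ and $d$ a $\mu^2$-measurable function, $\tau_r(X,d,\mu)\in\mathrm{Prob}(M_r)$ is the push-forward of $\mu^r$ along $\rho_r^{X,d}$. For a nontrivial finite tree, $\tau_r(T)=\tau_r(T,d_T,\mu_T)$.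 Real trees. A real tree is a non-empty complete metric space $(T,d)$ such that for any two distinct points $p,q\in T$ there is an isometric embedding $\alpha:[a,b]\to T$ of an interval with $\alpha(a)=p$, $\alpha(b)=q$ and such that for every $a<c<b$ the points $p$ and $q$ are in distinct connected components of $T\setminus\{\alpha(c)\}$. For $p\in T$ the connected components of $T\setminus\{p\}$ are the $p$-branches; a branch of $T$ is a $p$-branch for some $p\in T$. Dendrons. A long dendron $D=(T,d,\nu)$ is a real tree $(T,d)$ together with a Borel probability measure $\nu$ on $A_D=T\times[0,\infty)$ (product topology) satisfying $\nu(B\times[0,\infty))>0$ for all branches $B$ of $T$. Define $d_D:A_D^2\to\mathbb{R}$ by $d_D((u,a),(v,b))=d(u,v)+a+b$. A long dendron $D$ is a dendron if $\nu^2(\{(x,y)\in A_D^2\mid d_D(x,y)>1\})=0$. For a long dendron, $\tau_r(D)=\tau_r(A_D,d_D,\nu)$. Two long dendrons $D=(T,d,\nu)$ and $D'=(T',d',\nu')$ are isomorphic if there is a (bijective) isometry $f$ from $(T,d)$ to $(T',d')$ such that $f':A_D\to A_{D'}$, $f'(p,a)=(f(p),a)$, is measure preserving from $\nu$ to $\nu'$. *)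

theory Defs
  imports "HOL-Analysis.Analysis" "HOL-Probability.Probability_Measure"
begin

text \<open>Finite simple graphs: a vertex set \<open>V\<close> and a symmetric irreflexive adjacency relation \<open>E\<close> on it.
  A path is the list of its vertices, so its length is one less than the length of the list.\<close>

definition gpath :: "'v set \<Rightarrow> 'v rel \<Rightarrow> 'v \<Rightarrow> 'v list \<Rightarrow> 'v \<Rightarrow> bool" where
  "gpath V E x xs y \<longleftrightarrow> xs \<noteq> [] \<and> hd xs = x \<and> last xs = y \<and> set xs \<subseteq> V \<and> distinct xs \<and>
     successively (\<lambda>u v. (u, v) \<in> E) xs"

definition gcycle :: "'v set \<Rightarrow> 'v rel \<Rightarrow> 'v list \<Rightarrow> bool" where
  "gcycle V E xs \<longleftrightarrow> length xs \<ge> 3 \<and> set xs \<subseteq> V \<and> distinct xs \<and>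
     successively (\<lambda>u v. (u, v) \<in> E) xs \<and> (last xs, hd xs) \<in> E"

definition finite_tree :: "'v set \<Rightarrow> 'v rel \<Rightarrow> bool" where
  "finite_tree V E \<longleftrightarrow> finite V \<and> V \<noteq> {} \<and> E \<subseteq> V \<times> V \<and> sym E \<and> irrefl E \<and>
     (\<forall>x\<in>V. \<forall>y\<in>V. \<exists>xs. gpath V E x xs y) \<and> \<not> (\<exists>xs. gcycle V E xs)"

definition nontrivial_finite_tree :: "'v set \<Rightarrow> 'v rel \<Rightarrow> bool" where
  "nontrivial_finite_tree V E \<longleftrightarrow> finite_tree V E \<and> card V \<ge> 2"

definition path_dist :: "'v set \<Rightarrow> 'v rel \<Rightarrow> 'v \<Rightarrow> 'v \<Rightarrow> nat" where
  "path_dist V E x y = (LEAST n. \<exists>xs. gpath V E x xs y \<and> length xs = Suc n)"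

definition path_diam :: "'v set \<Rightarrow> 'v rel \<Rightarrow> nat" where
  "path_diam V E = Max {path_dist V E x y | x y. x \<in> V \<and> y \<in> V}"

definition normalized_dist :: "'v set \<Rightarrow> 'v rel \<Rightarrow> 'v \<Rightarrow> 'v \<Rightarrow> real" where
  "normalized_dist V E x y = real (path_dist V E x y) / real (path_diam V E)"


text \<open>Real \<open>r \<times> r\<close> matrices are the extensional functions on \<open>{1..r} \<times> {1..r}\<close>. The product
  \<open>\<sigma>\<close>-algebra used in \<open>sampling_measure\<close> is the Borel \<open>\<sigma>\<close>-algebra of \<open>matrix_topology r\<close>, because
  the product is finite and the real line is second countable.\<close>

definition matrix_topology :: "nat \<Rightarrow> (nat \<times> nat \<Rightarrow> real) topology" where
  "matrix_topology r = product_topology (\<lambda>_. euclideanreal) ({1..r} \<times> {1..r})"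

definition sampling_map :: "nat \<Rightarrow> ('x \<Rightarrow> 'x \<Rightarrow> real) \<Rightarrow> (nat \<Rightarrow> 'x) \<Rightarrow> (nat \<times> nat \<Rightarrow> real)" where
  "sampling_map r d x =
     restrict (\<lambda>(i, j). if i = j then 0 else d (x i) (x j)) ({1..r} \<times> {1..r})"

definition sampling_measure ::
    "nat \<Rightarrow> ('x \<Rightarrow> 'x \<Rightarrow> real) \<Rightarrow> 'x measure \<Rightarrow> (nat \<times> nat \<Rightarrow> real) measure" where
  "sampling_measure r d \<mu> =
     distr (Pi\<^sub>M {1..r} (\<lambda>_. \<mu>)) (Pi\<^sub>M ({1..r} \<times> {1..r}) (\<lambda>_. borel)) (sampling_map r d)"

definition tree_sampling :: "nat \<Rightarrow> 'v set \<Rightarrow> 'v rel \<Rightarrow> (nat \<times> nat \<Rightarrow> real) measure" where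
  "tree_sampling r V E = sampling_measure r (normalized_dist V E) (uniform_count_measure V)"

definition weakly_converges ::
    "'x topology \<Rightarrow> (nat \<Rightarrow> 'x measure) \<Rightarrow> 'x measure \<Rightarrow> bool" where
  "weakly_converges X M N \<longleftrightarrow>
     (\<forall>f. continuous_map X euclideanreal f \<and> (\<exists>B. \<forall>x\<in>topspace X. \<bar>f x\<bar> \<le> B) \<longrightarrow>
        (\<lambda>n. \<integral>x. f x \<partial>M n) \<longlonglongrightarrow> (\<integral>x. f x \<partial>N))"


text \<open>A real tree is a subset \<open>T\<close> of a metric-space type with the restricted metric. Completeness and
  connectedness depend only on that metric, and \<open>T = UNIV\<close> is allowed, so no generality is lost.\<close>

definition real_tree :: "'a::metric_space set \<Rightarrow> bool" where
  "real_tree T \<longleftrightarrow> T \<noteq> {} \<and> complete T \<and>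
     (\<forall>p\<in>T. \<forall>q\<in>T. p \<noteq> q \<longrightarrow>
        (\<exists>(a::real) b \<alpha>. a \<le> b \<and> \<alpha> ` {a..b} \<subseteq> T \<and>
           (\<forall>s\<in>{a..b}. \<forall>t\<in>{a..b}. dist (\<alpha> s) (\<alpha> t) = dist s t) \<and>
           \<alpha> a = p \<and> \<alpha> b = q \<and>
           (\<forall>c. a < c \<and> c < b \<longrightarrow>
              connected_component_set (T - {\<alpha> c}) p \<noteq> connected_component_set (T - {\<alpha> c}) q)))"

definition tree_branch :: "'a::metric_space set \<Rightarrow> 'a set \<Rightarrow> bool" where
  "tree_branch T B \<longleftrightarrow> (\<exists>p\<in>T. B \<in> components (T - {p}))"

text \<open>The \<open>\<sigma>\<close>-algebra below is the Borel \<open>\<sigma>\<close>-algebra of the subspace \<open>T \<times> {0..}\<close>. The positivity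
  condition forces \<open>T\<close> to be separable, so \<open>dendron_dist\<close> is measurable for \<open>\<nu> \<Otimes>\<^sub>M \<nu>\<close>.\<close>

definition long_dendron :: "'a::metric_space set \<Rightarrow> ('a \<times> real) measure \<Rightarrow> bool" where
  "long_dendron T \<nu> \<longleftrightarrow> real_tree T \<and> prob_space \<nu> \<and>
     sets \<nu> = sets (restrict_space borel (T \<times> {0..})) \<and>
     (\<forall>B. tree_branch T B \<longrightarrow> measure \<nu> (B \<times> {0..}) > 0)"

definition dendron_dist :: "'a::metric_space \<times> real \<Rightarrow> 'a \<times> real \<Rightarrow> real" where
  "dendron_dist x y = dist (fst x) (fst y) + snd x + snd y"

definition dendron :: "'a::metric_space set \<Rightarrow> ('a \<times> real) measure \<Rightarrow> bool" where
  "dendron T \<nu> \<longleftrightarrow> long_dendron T \<nu> \<and>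
     emeasure (\<nu> \<Otimes>\<^sub>M \<nu>) {(x, y). x \<in> T \<times> {0..} \<and> y \<in> T \<times> {0..} \<and> dendron_dist x y > 1} = 0"

definition dendron_sampling :: "nat \<Rightarrow> ('a::metric_space \<times> real) measure \<Rightarrow> (nat \<times> nat \<Rightarrow> real) measure" where
  "dendron_sampling r \<nu> = sampling_measure r dendron_dist \<nu>"

definition dendron_isomorphic ::
    "'a::metric_space set \<Rightarrow> ('a \<times> real) measure \<Rightarrow> 'b::metric_space set \<Rightarrow> ('b \<times> real) measure \<Rightarrow> bool" where
  "dendron_isomorphic T \<nu> T' \<nu>' \<longleftrightarrow>
     (\<exists>f. bij_betw f T T' \<and> (\<forall>p\<in>T. \<forall>q\<in>T. dist (f p) (f q) = dist p q) \<and>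
        (\<lambda>(p, a). (f p, a)) \<in> measurable \<nu> \<nu>' \<and>
        distr \<nu> \<nu>' (\<lambda>(p, a). (f p, a)) = \<nu>')"

end

theory Submission
  imports Defs "HOL-Probability.Hoeffding"
begin

text \<open>
  Equality of all \<open>\<tau>\<^sub>r\<close> means that i.i.d. samples of the two long dendrons produce infinite distance
  matrices with the same law. In each dendron the samples whose empirical measures are asymptotically
  at least \<open>\<nu>\<close> on every open set contain a compact set of probability above \<open>1/2\<close>. Its image under
  the continuous distance matrix map is compact and again has probability above \<open>1/2\<close>, so the images
  for the two dendrons intersect: some sample \<open>(u\<^sub>i, a\<^sub>i)\<close> of \<open>D\<close> and some sample \<open>(u'\<^sub>i, a'\<^sub>i)\<close> of \<open>D'\<close>,
  both equidistributed, have the same matrix. Working with compact sets avoids the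
  non-measurability of images of general sets.

  Since every branch is hit infinitely often, the height \<open>a\<^sub>i\<close> is the infimum of
  \<open>(d\<^sub>i\<^sub>j + d\<^sub>i\<^sub>k - d\<^sub>j\<^sub>k) / 2\<close> over distinct \<open>j, k \<noteq> i\<close>, so heights and distances \<open>d(u\<^sub>i, u\<^sub>j)\<close> agree.
  Moreover \<open>d(p, q)\<close> is the supremum of \<open>d(u\<^sub>i, q) - d(u\<^sub>i, p)\<close>, and the points separating some
  \<open>u\<^sub>j\<close> from some \<open>u\<^sub>k\<close> are dense, with distances to all \<open>u\<^sub>i\<close> determined by the sample distances.
  Hence \<open>u\<^sub>i \<mapsto> u'\<^sub>i\<close> extends to an isometry of the trees, and equidistribution of the two samples
  shows that it preserves the measures.
\<close>

subsection \<open>Separation in real trees\<close>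

text \<open>Membership is part of the definition because \<open>connected_component_set\<close> of a
  point outside the set is empty; bare inequality of components would already hold between
  \<open>c\<close> itself and any other point of the tree.\<close>

definition separates :: "'a::metric_space set \<Rightarrow> 'a \<Rightarrow> 'a \<Rightarrow> 'a \<Rightarrow> bool" where
  "separates T c x y \<longleftrightarrow> c \<in> T \<and> x \<in> T - {c} \<and> y \<in> T - {c} \<and>
     connected_component_set (T - {c}) x \<noteq> connected_component_set (T - {c}) y"

text \<open>The segment is shifted to start at time 0, so that time is distance from
  \<open>p\<close>. The case \<open>p = q\<close> is covered by a constant path, which spares later
  case distinctions.\<close>

lemma real_tree_segment:
  assumes T: "real_tree T" and "p \<in> T" "q \<in> T"
  obtains \<gamma> where "\<gamma> ` {0..dist p q} \<subseteq> T"
    and "\<And>s t. s \<in> {0..dist p q} \<Longrightarrow> t \<in> {0..dist p q} \<Longrightarrow> dist (\<gamma> s) (\<gamma> t) = \<bar>s - t\<bar>"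
    and "\<gamma> 0 = p" "\<gamma> (dist p q) = q"
    and "\<And>s. 0 < s \<Longrightarrow> s < dist p q \<Longrightarrow> separates T (\<gamma> s) p q"
proof (cases "p = q")
  case True
  show ?thesis
    by (rule that[of "\<lambda>_. p"]) (use True \<open>p \<in> T\<close> in auto)
next
  case False
  note ex = T[unfolded real_tree_def, THEN conjunct2, THEN conjunct2, THEN bspec, OF \<open>p \<in> T\<close>,
      THEN bspec, OF \<open>q \<in> T\<close>, THEN mp, OF False]
  obtain a b :: real and \<alpha> where ab: "a \<le> b" and im: "\<alpha> ` {a..b} \<subseteq> T"
    and iso': "\<forall>s\<in>{a..b}. \<forall>t\<in>{a..b}. dist (\<alpha> s) (\<alpha> t) = dist s t"
    and ends: "\<alpha> a = p" "\<alpha> b = q"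
    and sep': "\<forall>c. a < c \<and> c < b \<longrightarrow>
      connected_component_set (T - {\<alpha> c}) p \<noteq> connected_component_set (T - {\<alpha> c}) q"
    by (rule exE[OF ex], elim exE conjE) (rule that)
  note iso = iso'[rule_format] and sep = sep'[rule_format]
  have D: "dist p q = b - a"
    using iso[of a b] ab ends by (simp add: dist_real_def)
  show ?thesis
  proof (rule that[of "\<lambda>s. \<alpha> (a + s)"])
    show "(\<lambda>s. \<alpha> (a + s)) ` {0..dist p q} \<subseteq> T"
      using im D by auto
    show "dist (\<alpha> (a + s)) (\<alpha> (a + t)) = \<bar>s - t\<bar>" if "s \<in> {0..dist p q}" "t \<in> {0..dist p q}" for s t
      using iso[of "a + s" "a + t"] that D by (simp add: dist_real_def)
    show "\<alpha> (a + 0) = p" "\<alpha> (a + dist p q) = q"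
      using ends D by auto
    show "separates T (\<alpha> (a + s)) p q" if "0 < s" "s < dist p q" for s
    proof -
      have "dist p (\<alpha> (a + s)) = s" "dist q (\<alpha> (a + s)) = b - a - s"
        using iso[of a "a + s"] iso[of b "a + s"] that D ends by (auto simp: dist_real_def)
      with that D im sep[of "a + s"] assms show ?thesis
        by (auto simp: separates_def)
    qed
  qed
qed

text \<open>The segment from \<open>x\<close> to \<open>y\<close> is connected, so it cannot stay
  inside \<open>T - {c}\<close>. It therefore passes through \<open>c\<close>, and distances add
  along it.\<close>

lemma separates_dist:
  assumes T: "real_tree T" and sep: "separates T c x y"
  shows "dist x y = dist x c + dist c y"
proof -
  have xy: "x \<in> T" "y \<in> T" using sep by (auto simp: separates_def)
  obtain \<gamma> where \<gamma>: "\<gamma> ` {0..dist x y} \<subseteq> T"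
    and iso: "\<And>s t. s \<in> {0..dist x y} \<Longrightarrow> t \<in> {0..dist x y} \<Longrightarrow> dist (\<gamma> s) (\<gamma> t) = \<bar>s - t\<bar>"
    and ends: "\<gamma> 0 = x" "\<gamma> (dist x y) = y"
    using real_tree_segment[OF T xy] by metis
  have cont: "continuous_on {0..dist x y} \<gamma>"
    unfolding continuous_on_iff using iso by (auto simp: dist_real_def)
  have conn: "connected (\<gamma> ` {0..dist x y})"
    by (intro connected_continuous_image cont) simp
  have mem: "x \<in> \<gamma> ` {0..dist x y}" "y \<in> \<gamma> ` {0..dist x y}"
    using ends by (metis atLeastAtMost_iff imageI order_refl zero_le_dist)+
  have "c \<in> \<gamma> ` {0..dist x y}"
  proof (rule ccontr)
    assume "c \<notin> \<gamma> ` {0..dist x y}"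
    with \<gamma> have "\<gamma> ` {0..dist x y} \<subseteq> T - {c}" by auto
    then have "connected_component (T - {c}) x y"
      using conn mem unfolding connected_component_def by blast
    then have "y \<in> connected_component_set (T - {c}) x" by simp
    from connected_component_eq[OF this] sep show False
      by (simp add: separates_def)
  qed
  then obtain s where s: "s \<in> {0..dist x y}" "c = \<gamma> s" by auto
  with iso[of 0 s] iso[of s "dist x y"] ends show ?thesis by auto
qed

lemma separates_cases:
  assumes "separates T c x y" "z \<in> T - {c}"
  shows "separates T c x z \<or> separates T c y z"
  using assms by (auto simp: separates_def)

text \<open>Any \<open>z\<close> other than \<open>c\<close> is separated by \<open>c\<close> from
  \<open>x\<close> or from \<open>y\<close>, which makes one of the two differences exact, while the
  triangle inequality bounds both. All distances from \<open>c\<close> are thus computable from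
  those of \<open>x\<close> and \<open>y\<close>, which is what lets \<open>c\<close> be copied into
  another tree.\<close>

lemma separates_dist_point:
  assumes T: "real_tree T" and sep: "separates T c x y" and z: "z \<in> T"
  shows "dist c z = max (dist x z - dist x c) (dist y z - dist y c)"
proof (cases "z = c")
  case True
  then show ?thesis by simp
next
  case False
  from separates_cases[OF sep] False z have "separates T c x z \<or> separates T c y z" by auto
  then have "dist x z = dist x c + dist c z \<or> dist y z = dist y c + dist c z"
    using separates_dist[OF T] by blast
  moreover have "dist x z \<le> dist x c + dist c z" "dist y z \<le> dist y c + dist c z"
    by (rule dist_triangle)+
  ultimately show ?thesis by linarith
qed

text \<open>A segment from \<open>x\<close> that is shorter than \<open>dist x p\<close> cannot meet
  \<open>p\<close>, so the ball of that radius stays in the branch of \<open>x\<close>. Relative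
  openness makes branches measurable and accessible to equidistribution.\<close>

lemma tree_branch_openin:
  assumes T: "real_tree T" and B: "tree_branch T B"
  obtains G where "open G" "B = T \<inter> G"
proof -
  from B obtain p where p: "p \<in> T" and B: "B \<in> components (T - {p})"
    by (auto simp: tree_branch_def)
  have BT: "B \<subseteq> T - {p}" using in_components_subset[OF B] .
  define G where "G = (\<Union>x\<in>B. ball x (dist x p))"
  have "y \<in> B" if x: "x \<in> B" and y: "y \<in> T" "dist x y < dist x p" for x y
  proof -
    have xT: "x \<in> T" using x BT by auto
    obtain \<gamma> where \<gamma>: "\<gamma> ` {0..dist x y} \<subseteq> T"
      and iso: "\<And>s t. s \<in> {0..dist x y} \<Longrightarrow> t \<in> {0..dist x y} \<Longrightarrow> dist (\<gamma> s) (\<gamma> t) = \<bar>s - t\<bar>"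
      and ends: "\<gamma> 0 = x" "\<gamma> (dist x y) = y"
      using real_tree_segment[OF T xT y(1)] by metis
    have "continuous_on {0..dist x y} \<gamma>"
      unfolding continuous_on_iff using iso by (auto simp: dist_real_def)
    then have conn: "connected (\<gamma> ` {0..dist x y})"
      by (intro connected_continuous_image) auto
    have mem: "x \<in> \<gamma> ` {0..dist x y}" "y \<in> \<gamma> ` {0..dist x y}"
      using ends by (metis atLeastAtMost_iff imageI order_refl zero_le_dist)+
    have "p \<notin> \<gamma> ` {0..dist x y}"
    proof
      assume "p \<in> \<gamma> ` {0..dist x y}"
      then obtain s where "s \<in> {0..dist x y}" "p = \<gamma> s" by auto
      with iso[of 0 s] ends y show False by auto
    qed
    with \<gamma> have "\<gamma> ` {0..dist x y} \<subseteq> T - {p}" by auto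
    from components_maximal[OF B conn this] mem x show "y \<in> B" by blast
  qed
  then have "B = T \<inter> G"
    using BT by (fastforce simp: G_def)
  moreover have "open G" unfolding G_def by auto
  ultimately show ?thesis using that by blast
qed

text \<open>Separation depends only on the two branches, so \<open>x\<close> and \<open>y\<close>
  can be replaced by any representatives, in particular by sample points.\<close>

lemma separates_branches:
  assumes "separates T c x y"
  defines "B \<equiv> connected_component_set (T - {c}) x" and "C \<equiv> connected_component_set (T - {c}) y"
  shows "tree_branch T B" "tree_branch T C" "x \<in> B" "y \<in> C"
    and "\<And>u v. u \<in> B \<Longrightarrow> v \<in> C \<Longrightarrow> separates T c u v"
proof -
  have *: "x \<in> T - {c}" "y \<in> T - {c}" "c \<in> T" using assms by (auto simp: separates_def)
  show "tree_branch T B" "tree_branch T C"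
    using * unfolding tree_branch_def B_def C_def components_def by blast+
  show "x \<in> B" "y \<in> C" using * by (auto simp: B_def C_def)
  show "separates T c u v" if "u \<in> B" "v \<in> C" for u v
  proof -
    have "connected_component_set (T - {c}) u = B" "connected_component_set (T - {c}) v = C"
      using that unfolding B_def C_def by (simp_all add: connected_component_eq)
    moreover have "u \<in> T - {c}" "v \<in> T - {c}"
      using that connected_component_subset unfolding B_def C_def by fast+
    ultimately show ?thesis using assms(1) * by (auto simp: separates_def B_def C_def)
  qed
qed

lemma real_tree_dense_separating:
  assumes T: "real_tree T" and p: "p \<in> T" and q: "q \<in> T" "q \<noteq> p" and "e > 0"
  obtains c where "dist p c < e" "separates T c p q"
proof -
  obtain \<gamma> where \<gamma>: "\<gamma> ` {0..dist p q} \<subseteq> T"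
    and iso: "\<And>s t. s \<in> {0..dist p q} \<Longrightarrow> t \<in> {0..dist p q} \<Longrightarrow> dist (\<gamma> s) (\<gamma> t) = \<bar>s - t\<bar>"
    and ends: "\<gamma> 0 = p" "\<gamma> (dist p q) = q"
    and sep: "\<And>s. 0 < s \<Longrightarrow> s < dist p q \<Longrightarrow> separates T (\<gamma> s) p q"
    using real_tree_segment[OF T p q(1)] by metis
  define s where "s = min e (dist p q) / 2"
  have "0 < s" "s < dist p q" "s < e" using \<open>e > 0\<close> q by (auto simp: s_def min_def)
  then show ?thesis
    using that[of "\<gamma> s"] sep[of s] iso[of 0 s] ends by auto
qed

subsection \<open>Reconstructing a real tree from a branch-recurrent sequence\<close>

text \<open>Infinitely many visits, rather than one, leave room to pick indices different from a
  given one. This matters because the diagonal of a sampled matrix carries no information.\<close>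

definition branch_recurrent :: "'a::metric_space set \<Rightarrow> (nat \<Rightarrow> 'a) \<Rightarrow> bool" where
  "branch_recurrent T u \<longleftrightarrow> range u \<subseteq> T \<and> (\<forall>B. tree_branch T B \<longrightarrow> infinite {i. u i \<in> B})"

lemma branch_recurrent_separates:
  assumes u: "branch_recurrent T u" and sep: "separates T c x y"
  obtains j k where "j > n" "k > n" "separates T c (u j) (u k)" "separates T c (u j) y"
    "j \<noteq> k"
proof -
  note br = separates_branches[OF sep]
  have "infinite {i. u i \<in> connected_component_set (T - {c}) x}"
    "infinite {i. u i \<in> connected_component_set (T - {c}) y}"
    using u br(1,2) unfolding branch_recurrent_def by blast+
  then obtain j k where jk: "j > n" "u j \<in> connected_component_set (T - {c}) x"
    "k > n" "u k \<in> connected_component_set (T - {c}) y"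
    unfolding infinite_nat_iff_unbounded by blast
  have "separates T c (u j) (u k)" "separates T c (u j) y"
    using br(4,5) jk by blast+
  moreover from this have "j \<noteq> k" by (auto simp: separates_def)
  ultimately show ?thesis using that jk by blast
qed

text \<open>Half of the bounded expression is the Gromov product of \<open>u j\<close> and
  \<open>u k\<close> at \<open>u i\<close>. It is small when a point \<open>c\<close> near
  \<open>u i\<close> separates \<open>u j\<close> from \<open>u k\<close>, because their segment
  then passes close to \<open>u i\<close>.\<close>

lemma branch_recurrent_gromov_product:
  assumes T: "real_tree T" and u: "branch_recurrent T u" and "e > 0"
  obtains j k where "j \<noteq> i" "k \<noteq> i" "j \<noteq> k"
    "dist (u i) (u j) + dist (u i) (u k) - dist (u j) (u k) \<le> e"
proof (cases "T = {u i}")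
  \<comment> \<open>A one-point tree has no branches, so recurrence gives nothing; but then all
    samples coincide and any two further indices work.\<close>
  case True
  then have "u j = u i" for j using u unfolding branch_recurrent_def by fast
  from this[of "i + 1"] this[of "i + 2"] show ?thesis
    using that[of "i + 1" "i + 2"] \<open>e > 0\<close> by simp
next
  case False
  have ui: "u i \<in> T" using u by (auto simp: branch_recurrent_def)
  with False obtain q where q: "q \<in> T" "q \<noteq> u i" by auto
  obtain c where c: "dist (u i) c < e / 2" "separates T c (u i) q"
    using real_tree_dense_separating[OF T ui q, of "e / 2"] \<open>e > 0\<close> by auto
  obtain j k where jk: "j > i" "k > i" "separates T c (u j) (u k)" "j \<noteq> k"
    using branch_recurrent_separates[OF u c(2)] by metis
  have "dist (u j) (u k) = dist (u j) c + dist c (u k)"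
    using separates_dist[OF T jk(3)] .
  moreover have "dist (u i) (u j) \<le> dist (u i) c + dist (u j) c"
    "dist (u i) (u k) \<le> dist (u i) c + dist c (u k)"
    using dist_triangle[of "u i" "u j" c] dist_triangle[of "u i" "u k" c] by (auto simp: dist_commute)
  ultimately show ?thesis using that[of j k] jk c(1) by auto
qed

text \<open>Take \<open>c\<close> near \<open>p\<close> on the way to \<open>q\<close> and a sample
  in the branch of \<open>p\<close> at \<open>c\<close>. The segment from this sample to
  \<open>q\<close> passes through \<open>c\<close>, hence almost through \<open>p\<close>.\<close>

lemma branch_recurrent_norming:
  assumes T: "real_tree T" and u: "branch_recurrent T u" and p: "p \<in> T" and q: "q \<in> T" and "e > 0"
  obtains i where "dist p q - e \<le> dist (u i) q - dist (u i) p"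
proof (cases "q = p")
  case True
  then show ?thesis using that \<open>e > 0\<close> by simp
next
  case False
  obtain c where c: "dist p c < e / 2" "separates T c p q"
    using real_tree_dense_separating[OF T p q False, of "e / 2"] \<open>e > 0\<close> by auto
  obtain i where i: "separates T c (u i) q"
    using branch_recurrent_separates[OF u c(2)] by metis
  have "dist (u i) q = dist (u i) c + dist c q" "dist p q = dist p c + dist c q"
    using separates_dist[OF T i] separates_dist[OF T c(2)] by auto
  moreover have "dist (u i) p \<le> dist (u i) c + dist p c"
    using dist_triangle[of "u i" p c] by (simp add: dist_commute)
  ultimately have "dist p q - e \<le> dist (u i) q - dist (u i) p" using c(1) by linarith
  then show ?thesis using that by blast
qed

text \<open>The form in which norming is applied: an upper bound on a distance need only be tested
  against the samples.\<close>

lemma branch_recurrent_dist_le: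
  assumes T: "real_tree T" and u: "branch_recurrent T u" and p: "p \<in> T" and q: "q \<in> T"
    and le: "\<And>i. dist (u i) q - dist (u i) p \<le> r"
  shows "dist p q \<le> r"
proof (rule field_le_epsilon)
  fix e :: real assume "e > 0"
  obtain i where "dist p q - e \<le> dist (u i) q - dist (u i) p"
    using branch_recurrent_norming[OF T u p q \<open>e > 0\<close>] .
  with le[of i] show "dist p q \<le> r + e" by simp
qed

text \<open>Near \<open>p\<close> there is a point \<open>c\<close> separating two samples
  \<open>u j\<close> and \<open>u k\<close>. Its partner is the point at the same distance from
  \<open>u' j\<close> on the segment to \<open>u' k\<close>; by \<open>separates_dist_point\<close>
  its distances to all samples are given by the same formula in the same numbers.\<close>

lemma branch_recurrent_transfer_dense:
  assumes T: "real_tree T" and u: "branch_recurrent T u"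
    and T': "real_tree T'" and u': "branch_recurrent T' u'"
    and same: "\<And>i j. dist (u' i) (u' j) = dist (u i) (u j)"
    and p: "p \<in> T" and "e > 0"
  obtains c c' where "c \<in> T" "dist p c < e" "c' \<in> T'" "\<And>i. dist c' (u' i) = dist c (u i)"
proof (cases "T = {p}")
  \<comment> \<open>In a one-point tree all samples coincide, so by \<open>same\<close> those of
    \<open>T'\<close> coincide too, and \<open>u' 0\<close> is the partner.\<close>
  case True
  have "u 0 \<in> T" "u' 0 \<in> T'" using u u' by (auto simp: branch_recurrent_def)
  then show ?thesis using that[of p "u' 0"] True p same[of 0] \<open>e > 0\<close> by auto
next
  case False
  with p obtain q where q: "q \<in> T" "q \<noteq> p" by auto
  obtain c where c: "dist p c < e" "separates T c p q"
    using real_tree_dense_separating[OF T p q \<open>e > 0\<close>] by auto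
  obtain j k where jk: "separates T c (u j) (u k)"
    using branch_recurrent_separates[OF u c(2)] by metis
  have D: "dist (u j) (u k) = dist (u j) c + dist c (u k)"
    using separates_dist[OF T jk] .
  have uT: "u i \<in> T" "u' i \<in> T'" for i using u u' by (auto simp: branch_recurrent_def)
  obtain \<gamma> where
    iso: "\<And>s t. s \<in> {0..dist (u' j) (u' k)} \<Longrightarrow> t \<in> {0..dist (u' j) (u' k)} \<Longrightarrow> dist (\<gamma> s) (\<gamma> t) = \<bar>s - t\<bar>"
    and ends: "\<gamma> 0 = u' j" "\<gamma> (dist (u' j) (u' k)) = u' k"
    and sep: "\<And>s. 0 < s \<Longrightarrow> s < dist (u' j) (u' k) \<Longrightarrow> separates T' (\<gamma> s) (u' j) (u' k)"
    using real_tree_segment[OF T' uT(2) uT(2)] by metis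
  define s where "s = dist (u j) c"
  have s: "0 < s" "s < dist (u' j) (u' k)"
    using jk D by (auto simp: s_def same separates_def)
  have sep': "separates T' (\<gamma> s) (u' j) (u' k)" using sep[OF s] .
  have d: "dist (u' j) (\<gamma> s) = dist (u j) c" "dist (u' k) (\<gamma> s) = dist (u k) c"
    using iso[of 0 s] iso[of "dist (u' j) (u' k)" s] s ends D by (auto simp: s_def same dist_commute)
  have "dist (\<gamma> s) (u' i) = dist c (u i)" for i
    using separates_dist_point[OF T' sep' uT(2)[of i]] separates_dist_point[OF T jk uT(1)[of i]]
    by (simp add: d same)
  moreover have "\<gamma> s \<in> T'" "c \<in> T" using sep' jk by (auto simp: separates_def)
  ultimately show ?thesis using that c(1) by blast
qed

text \<open>Points with partners converge to \<open>p\<close>. By norming in \<open>T'\<close> the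
  partners are no further apart than the originals, so they form a Cauchy sequence, and completeness
  of \<open>T'\<close> supplies the partner of \<open>p\<close> as their limit.\<close>

lemma branch_recurrent_transfer:
  assumes T: "real_tree T" and u: "branch_recurrent T u"
    and T': "real_tree T'" and u': "branch_recurrent T' u'"
    and same: "\<And>i j. dist (u' i) (u' j) = dist (u i) (u j)"
    and p: "p \<in> T"
  obtains p' where "p' \<in> T'" "\<And>i. dist p' (u' i) = dist p (u i)"
proof -
  have "\<exists>c c'. c \<in> T \<and> dist p c < 1 / real (Suc n) \<and> c' \<in> T' \<and> (\<forall>i. dist c' (u' i) = dist c (u i))" for n
    using branch_recurrent_transfer_dense[OF T u T' u' same p, of "1 / real (Suc n)"]
    by (metis of_nat_0_less_iff zero_less_Suc zero_less_divide_1_iff)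
  then obtain c c' where c: "\<And>n. c n \<in> T" "\<And>n. dist p (c n) < 1 / real (Suc n)" "\<And>n. c' n \<in> T'"
    and same': "\<And>n i. dist (c' n) (u' i) = dist (c n) (u i)"
    by metis
  have lim: "c \<longlonglongrightarrow> p"
  proof (rule metric_LIMSEQ_I)
    fix r :: real assume "r > 0"
    then obtain N where N: "1 / real (Suc N) < r" using nat_approx_posE by blast
    have "dist (c n) p < r" if "n \<ge> N" for n
    proof -
      have "1 / real (Suc n) \<le> 1 / real (Suc N)" using that by (auto simp: field_simps)
      with N c(2)[of n] show ?thesis by (simp add: dist_commute)
    qed
    then show "\<exists>N. \<forall>n\<ge>N. dist (c n) p < r" by blast
  qed
  have le: "dist (c' n) (c' m) \<le> dist (c n) (c m)" for n m
  proof (rule branch_recurrent_dist_le[OF T' u' c(3) c(3)])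
    show "dist (u' i) (c' m) - dist (u' i) (c' n) \<le> dist (c n) (c m)" for i
      using same'[of m i] same'[of n i] dist_triangle[of "u i" "c m" "c n"] by (simp add: dist_commute)
  qed
  have "Cauchy c" using lim LIMSEQ_imp_Cauchy by blast
  then have "Cauchy c'"
    unfolding Cauchy_def using le by (meson le_less_trans)
  moreover have "complete T'" using T' by (simp add: real_tree_def)
  ultimately obtain p' where p': "p' \<in> T'" "c' \<longlonglongrightarrow> p'"
    using c(3) unfolding complete_def by blast
  have "dist p' (u' i) = dist p (u i)" for i
  proof (rule LIMSEQ_unique)
    show "(\<lambda>n. dist (c' n) (u' i)) \<longlonglongrightarrow> dist p' (u' i)" by (intro tendsto_intros p')
    show "(\<lambda>n. dist (c' n) (u' i)) \<longlonglongrightarrow> dist p (u i)" unfolding same' by (intro tendsto_intros lim)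
  qed
  with p' that show ?thesis by blast
qed

text \<open>The image of \<open>p\<close> is the point with the same distances to the samples: it
  exists by transfer and is unique by norming. Norming in each tree gives one of the two distance
  inequalities, and transfer in the opposite direction gives surjectivity.\<close>

lemma branch_recurrent_isometry:
  assumes T: "real_tree T" and u: "branch_recurrent T u"
    and T': "real_tree T'" and u': "branch_recurrent T' u'"
    and same: "\<And>i j. dist (u' i) (u' j) = dist (u i) (u j)"
  obtains f where "bij_betw f T T'" "\<And>p q. p \<in> T \<Longrightarrow> q \<in> T \<Longrightarrow> dist (f p) (f q) = dist p q"
    "\<And>i. f (u i) = u' i"
proof -
  define f where "f p = (SOME p'. p' \<in> T' \<and> (\<forall>i. dist p' (u' i) = dist p (u i)))" for p
  have f: "f p \<in> T'" "dist (f p) (u' i) = dist p (u i)" if "p \<in> T" for p i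
  proof -
    have "\<exists>p'. p' \<in> T' \<and> (\<forall>i. dist p' (u' i) = dist p (u i))"
      using branch_recurrent_transfer[OF T u T' u' same that] by metis
    from someI_ex[OF this] show "f p \<in> T'" "dist (f p) (u' i) = dist p (u i)"
      by (auto simp: f_def)
  qed
  have unique: "q = f p" if "p \<in> T" "q \<in> T'" "\<And>i. dist q (u' i) = dist p (u i)" for p q
  proof -
    have "dist (f p) q \<le> 0"
      by (rule branch_recurrent_dist_le[OF T' u' f(1)[OF that(1)] that(2)])
        (use f(2)[OF that(1)] that(3) in \<open>simp add: dist_commute\<close>)
    then show ?thesis by simp
  qed
  have iso: "dist (f p) (f q) = dist p q" if "p \<in> T" "q \<in> T" for p q
  proof (rule antisym)
    show "dist (f p) (f q) \<le> dist p q"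
    proof (rule branch_recurrent_dist_le[OF T' u' f(1)[OF that(1)] f(1)[OF that(2)]])
      show "dist (u' i) (f q) - dist (u' i) (f p) \<le> dist p q" for i
        using f(2)[OF that(1), of i] f(2)[OF that(2), of i] dist_triangle[of "u i" q p]
        by (simp add: dist_commute)
    qed
    show "dist p q \<le> dist (f p) (f q)"
    proof (rule branch_recurrent_dist_le[OF T u that])
      show "dist (u i) q - dist (u i) p \<le> dist (f p) (f q)" for i
        using f(2)[OF that(1), of i] f(2)[OF that(2), of i] dist_triangle[of "u' i" "f q" "f p"]
        by (simp add: dist_commute)
    qed
  qed
  have "inj_on f T"
    by (rule inj_onI) (metis iso dist_eq_0_iff)
  moreover have "f ` T = T'"
  proof
    show "f ` T \<subseteq> T'" using f by auto
    show "T' \<subseteq> f ` T"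
    proof
      fix q assume q: "q \<in> T'"
      obtain p where "p \<in> T" "\<And>i. dist p (u i) = dist q (u' i)"
        using branch_recurrent_transfer[OF T' u' T u same[symmetric] q] by blast
      with unique[of p q] q show "q \<in> f ` T" by auto
    qed
  qed
  moreover have "u i \<in> T" "u' i \<in> T'" for i
    using u u' by (auto simp: branch_recurrent_def)
  then have "f (u i) = u' i" for i
    by (intro unique[symmetric]) (auto simp: same)
  ultimately show ?thesis using that iso by (auto simp: bij_betw_def)
qed

text \<open>Adding the equations for \<open>(i, j)\<close> and \<open>(i, k)\<close> and subtracting
  that for \<open>(j, k)\<close> leaves twice the height at \<open>i\<close> plus twice the Gromov
  product at \<open>i\<close>. The product can be made small for \<open>u\<close> and is nonnegative
  for \<open>u'\<close>. Exchanging the two sides yields equality of heights.\<close>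

lemma branch_recurrent_heights:
  assumes T: "real_tree T" and u: "branch_recurrent T u"
    and eq: "\<And>i j. i \<noteq> j \<Longrightarrow> dist (u' i) (u' j) + a' i + a' j = dist (u i) (u j) + a i + a j"
  shows "a' i \<le> (a i :: real)"
proof (rule field_le_epsilon)
  fix e :: real assume "e > 0"
  then obtain j k where jk: "j \<noteq> i" "k \<noteq> i" "j \<noteq> k"
    "dist (u i) (u j) + dist (u i) (u k) - dist (u j) (u k) \<le> e"
    using branch_recurrent_gromov_product[OF T u] by metis
  have "dist (u' j) (u' k) \<le> dist (u' i) (u' j) + dist (u' i) (u' k)"
    using dist_triangle[of "u' j" "u' k" "u' i"] by (simp add: dist_commute)
  with jk eq[of i j] eq[of i k] eq[of j k] \<open>e > 0\<close> show "a' i \<le> a i + e" by auto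
qed

subsection \<open>Separability of long dendrons and measurability of the distance\<close>

lemma long_dendron_sets:
  assumes "long_dendron T \<nu>"
  shows "sets \<nu> = sets (restrict_space borel (T \<times> {0..}))" "space \<nu> = T \<times> {0..}"
    "real_tree T" "prob_space \<nu>"
proof -
  show *: "sets \<nu> = sets (restrict_space borel (T \<times> {0..}))" "real_tree T" "prob_space \<nu>"
    using assms by (auto simp: long_dendron_def)
  show "space \<nu> = T \<times> {0..}"
    using sets_eq_imp_space_eq[OF *(1)] by (simp add: space_restrict_space)
qed

lemma long_dendron_branch:
  assumes D: "long_dendron T \<nu>" and B: "tree_branch T B"
  shows "B \<times> {0..} \<in> sets \<nu>" "measure \<nu> (B \<times> {0..}) > 0"
proof -
  show "measure \<nu> (B \<times> {0..}) > 0" using assms by (auto simp: long_dendron_def)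
  obtain G where "open G" "B = T \<inter> G"
    using tree_branch_openin[OF long_dendron_sets(3)[OF D] B] .
  then have "open (G \<times> UNIV)" "B \<times> {0..} = (T \<times> {0..}) \<inter> (G \<times> UNIV)"
    by (auto intro!: open_Times)
  then show "B \<times> {0..} \<in> sets \<nu>"
    unfolding long_dendron_sets[OF D] sets_restrict_space by (metis borel_open image_eqI)
qed

text \<open>Both points lie on the segment from \<open>p\<close> to \<open>x\<close>. If they
  differed, \<open>c\<close> would separate \<open>c'\<close> from \<open>p\<close> or from
  \<open>x\<close>, and equal heights would force \<open>dist c c' = 0\<close>.\<close>

lemma separates_unique_height:
  assumes T: "real_tree T" and c: "separates T c p x" and c': "separates T c' p x"
    and h: "dist p c = dist p c'"
  shows "c = c'"
proof (rule ccontr)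
  assume "c \<noteq> c'"
  then have "c' \<in> T - {c}" using c' by (auto simp: separates_def)
  from separates_cases[OF c this] have "dist p c' = dist p c + dist c c' \<or> dist x c' = dist x c + dist c c'"
    using separates_dist[OF T] by blast
  moreover have "dist p x = dist p c + dist c x" "dist p x = dist p c' + dist c' x"
    by (rule separates_dist[OF T c]) (rule separates_dist[OF T c'])
  ultimately have "dist c c' = 0" using h by (auto simp: dist_commute)
  with \<open>c \<noteq> c'\<close> show False by simp
qed

text \<open>Distinct separating points at equal height above \<open>p\<close> carry disjoint branches, all of positive
  measure.\<close>

lemma long_dendron_level_countable:
  assumes D: "long_dendron T \<nu>"
  shows "countable {c. (\<exists>s. separates T c p s) \<and> dist p c = h}" (is "countable ?C")
proof -
  interpret prob_space \<nu> using long_dendron_sets[OF D] by simp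
  note T = long_dendron_sets(3)[OF D]
  define s where "s c = (SOME s. separates T c p s)" for c
  have s: "separates T c p (s c)" if "c \<in> ?C" for c
    using that by (auto simp: s_def intro: someI)
  define B where "B c = connected_component_set (T - {c}) (s c)" for c
  define f where "f c = measure \<nu> (B c \<times> {0..})" for c
  have br: "tree_branch T (B c)" if "c \<in> ?C" for c
    using separates_branches(2)[OF s[OF that]] by (simp add: B_def)
  have sep: "separates T c p x" if "c \<in> ?C" "x \<in> B c" for c x
    using separates_branches(3,5)[OF s[OF that(1)]] that(2) by (simp add: B_def)
  have disj: "disjoint_family_on (\<lambda>c. B c \<times> {0::real..}) ?C"
    unfolding disjoint_family_on_def
  proof (intro ballI impI)
    fix c c' assume c: "c \<in> ?C" "c' \<in> ?C" and "c \<noteq> c'"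
    have "x \<notin> B c'" if "x \<in> B c" for x
      using separates_unique_height[OF T sep[OF c(1) that] sep[OF c(2)]] c \<open>c \<noteq> c'\<close> by auto
    then show "(B c \<times> {0::real..}) \<inter> (B c' \<times> {0..}) = {}" by auto
  qed
  \<comment> \<open>Finite sums of measures of disjoint sets are at most 1, and a summable family of
    reals has only countably many nonzero members; here all members are positive.\<close>
  have "f summable_on ?C"
  proof (rule nonneg_bdd_above_summable_on)
    show "bdd_above (sum f ` {F. F \<subseteq> ?C \<and> finite F})"
    proof (rule bdd_aboveI2)
      fix F assume F: "F \<in> {F. F \<subseteq> ?C \<and> finite F}"
      have "sum f F = measure \<nu> (\<Union>c\<in>F. B c \<times> {0..})"
        unfolding f_def
      proof (rule finite_measure_finite_Union[symmetric])
        show "(\<lambda>c. B c \<times> {0..}) ` F \<subseteq> sets \<nu>"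
          using F by (auto intro!: long_dendron_branch(1)[OF D] br)
        show "disjoint_family_on (\<lambda>c. B c \<times> {0::real..}) F"
          by (rule disjoint_family_on_mono[OF _ disj]) (use F in auto)
      qed (use F in auto)
      then show "sum f F \<le> 1" by simp
    qed
  qed (simp add: f_def)
  then have "countable {c \<in> ?C. f c \<noteq> 0}"
    by (rule summable_countable_real)
  moreover have "f c > 0" if "c \<in> ?C" for c
    using long_dendron_branch(2)[OF D br[OF that]] by (simp add: f_def)
  then have "{c \<in> ?C. f c \<noteq> 0} = ?C" by force
  ultimately show ?thesis by simp
qed

text \<open>Every segment starting at \<open>p\<close> crosses all smaller rational heights at
  separating points, and each height carries only countably many of them. Points within
  \<open>e\<close> of \<open>p\<close> are approximated by \<open>p\<close> itself.\<close>

lemma long_dendron_separable: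
  assumes D: "long_dendron T \<nu>"
  obtains S where "countable S" "S \<subseteq> T" "T \<subseteq> closure S"
proof -
  note T = long_dendron_sets(3)[OF D]
  then obtain p where p: "p \<in> T" by (auto simp: real_tree_def)
  define S where "S = insert p (\<Union>h\<in>\<rat>. {c. (\<exists>s. separates T c p s) \<and> dist p c = h})"
  have "countable S"
    unfolding S_def using long_dendron_level_countable[OF D] by (simp add: countable_rat)
  moreover have "S \<subseteq> T" using p by (auto simp: S_def separates_def)
  moreover have "x \<in> closure S" if x: "x \<in> T" for x
    unfolding closure_approachable
  proof (intro allI impI)
    fix e :: real assume "e > 0"
    show "\<exists>y\<in>S. dist y x < e"
    proof (cases "dist p x < e")
      case True
      then show ?thesis by (auto simp: S_def)
    next
      case False
      obtain \<gamma> where iso: "\<And>s t. s \<in> {0..dist p x} \<Longrightarrow> t \<in> {0..dist p x} \<Longrightarrow> dist (\<gamma> s) (\<gamma> t) = \<bar>s - t\<bar>"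
        and ends: "\<gamma> 0 = p" "\<gamma> (dist p x) = x"
        and sep: "\<And>s. 0 < s \<Longrightarrow> s < dist p x \<Longrightarrow> separates T (\<gamma> s) p x"
        using real_tree_segment[OF T p x] by metis
      obtain h where h: "h \<in> \<rat>" "dist p x - e < h" "h < dist p x"
        using Rats_dense_in_real[of "dist p x - e" "dist p x"] \<open>e > 0\<close> by auto
      have "0 < h" using False h by simp
      then have "\<gamma> h \<in> S" "dist (\<gamma> h) x < e"
        using sep[of h] iso[of 0 h] iso[of h "dist p x"] ends h by (auto simp: S_def)
      then show ?thesis by blast
    qed
  qed
  ultimately show ?thesis using that by blast
qed

text \<open>On a nonseparable type the product of Borel algebras can miss open sets of the product,
  so continuity of \<open>dist\<close> alone does not suffice. Through a countable dense set the
  distance becomes a countable infimum of measurable functions.\<close>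

lemma dist_measurable_pair_separable:
  fixes T :: "'a::metric_space set"
  assumes S: "countable S" "T \<subseteq> closure S"
    and f: "f \<in> measurable M borel" "f \<in> space M \<rightarrow> T" and g: "g \<in> measurable M borel"
  shows "(\<lambda>x. dist (f x) (g x)) \<in> borel_measurable M"
proof (cases "space M = {}")
  case True
  then show ?thesis by (simp add: measurable_def)
next
  case False
  then have "S \<noteq> {}" using S f by auto
  have eq: "dist p q = (INF s\<in>S. dist p s + dist s q)" if "p \<in> T" for p q
  proof (rule antisym)
    show "dist p q \<le> (INF s\<in>S. dist p s + dist s q)"
      by (rule cINF_greatest[OF \<open>S \<noteq> {}\<close>]) (rule dist_triangle)
    show "(INF s\<in>S. dist p s + dist s q) \<le> dist p q"
    proof (rule field_le_epsilon)
      fix e :: real assume "e > 0"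
      have "p \<in> closure S" using S that by auto
      then obtain s where s: "s \<in> S" "dist s p < e / 2"
        unfolding closure_approachable using \<open>e > 0\<close> by (meson half_gt_zero)
      have "(INF s\<in>S. dist p s + dist s q) \<le> dist p s + dist s q"
        by (rule cINF_lower[OF _ s(1)]) (auto intro!: bdd_belowI2[of _ 0])
      also have "dist s q \<le> dist s p + dist p q" by (rule dist_triangle)
      finally show "(INF s\<in>S. dist p s + dist s q) \<le> dist p q + e"
        using s by (simp add: dist_commute)
    qed
  qed
  have "(\<lambda>p. dist p s) \<in> borel_measurable borel" "(\<lambda>p. dist s p) \<in> borel_measurable borel" for s :: 'a
    by (intro borel_measurable_continuous_onI continuous_intros)+
  note [measurable] = measurable_compose[OF f(1) this(1)] measurable_compose[OF g this(2)]
  have "(\<lambda>x. INF s\<in>S. dist (f x) s + dist s (g x)) \<in> borel_measurable M"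
    by (rule borel_measurable_cINF[OF S(1)]) (auto intro!: bdd_belowI2[of _ 0])
  then show ?thesis
    using eq f(2) by (subst measurable_cong[where g = "\<lambda>x. INF s\<in>S. dist (f x) s + dist s (g x)"]) auto
qed

lemma dendron_dist_measurable:
  assumes D: "long_dendron T \<nu>" and f: "f \<in> measurable M \<nu>" and g: "g \<in> measurable M \<nu>"
  shows "(\<lambda>x. dendron_dist (f x) (g x)) \<in> borel_measurable M"
proof -
  obtain S where S: "countable S" "T \<subseteq> closure S" using long_dendron_separable[OF D] by metis
  have meas: "fst \<in> measurable \<nu> borel" "snd \<in> measurable \<nu> borel"
    unfolding measurable_cong_sets[OF long_dendron_sets(1)[OF D] refl]
    by (auto intro!: measurable_restrict_space1 borel_measurable_continuous_onI continuous_intros)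
  note [measurable] = measurable_compose[OF f meas(2)] measurable_compose[OF g meas(2)]
  have [measurable]: "(\<lambda>x. dist (fst (f x)) (fst (g x))) \<in> borel_measurable M"
    using measurable_space[OF f] long_dendron_sets(2)[OF D]
    by (intro dist_measurable_pair_separable[OF S] measurable_compose[OF f meas(1)]
        measurable_compose[OF g meas(1)]) fastforce
  show ?thesis unfolding dendron_dist_def by measurable
qed

subsection \<open>Equidistributed sequences\<close>

text \<open>Union bound for the complements, with geometric weights that add up to
  \<open>e\<close>.\<close>

lemma (in prob_space) prob_INT_ge:
  assumes A: "\<And>n. A n \<in> events" and p: "\<And>n::nat. 1 - e * (1 / 2) ^ Suc n \<le> prob (A n)"
  shows "1 - e \<le> prob (\<Inter>n. A n)"
proof -
  have sums: "(\<lambda>n. e * (1 / 2) ^ Suc n) sums e"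
    using sums_mult[OF power_half_series, of e] by simp
  have le: "prob (space M - A n) \<le> e * (1 / 2) ^ Suc n" for n
    using prob_compl[OF A[of n]] p[of n] by simp
  have summable: "summable (\<lambda>n. prob (space M - A n))"
    by (rule summable_comparison_test'[OF sums_summable[OF sums]]) (use le in simp)
  have "prob (\<Union>n. space M - A n) \<le> (\<Sum>n. prob (space M - A n))"
    using A by (intro finite_measure_subadditive_countably summable) auto
  also have "\<dots> \<le> e"
    using suminf_le[OF le summable sums_summable[OF sums]] sums_unique[OF sums] by simp
  also have "(\<Union>n. space M - A n) = space M - (\<Inter>n. A n)" by auto
  finally have "prob (space M - (\<Inter>n. A n)) \<le> e" .
  moreover have "(\<Inter>n. A n) \<in> events" using A by auto
  ultimately show ?thesis using prob_compl by simp
qed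

definition hit_frequency :: "nat \<Rightarrow> (nat \<Rightarrow> 'a) \<Rightarrow> 'a set \<Rightarrow> real" where
  "hit_frequency n x G = real (card {i. i < n \<and> x i \<in> G}) / real n"

text \<open>Sampling along the sparse times \<open>64 ^ m\<close> makes the concentration bounds summable by explicit
  constants, so that the exceptional sets can be avoided by a single compact set of samples.\<close>

definition equidistributed :: "'a::topological_space measure \<Rightarrow> (nat \<Rightarrow> 'a) \<Rightarrow> bool" where
  "equidistributed M x \<longleftrightarrow> range x \<subseteq> space M \<and>
     (\<forall>G e. open G \<longrightarrow> e > 0 \<longrightarrow>
        (\<exists>N. \<forall>m\<ge>N. measure M (G \<inter> space M) - e \<le> hit_frequency (64 ^ m) x G))"

lemma hit_frequency_mono: "G \<subseteq> H \<Longrightarrow> hit_frequency n x G \<le> hit_frequency n x H"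
  unfolding hit_frequency_def by (intro divide_right_mono of_nat_mono card_mono) auto

lemma hit_frequency_sum:
  "hit_frequency n x G = (\<Sum>i<n. indicator G (x i)) / real n"
proof -
  have "{i. i < n \<and> x i \<in> G} = {..<n} \<inter> {i. x i \<in> G}" by auto
  then show ?thesis
    by (simp add: hit_frequency_def indicator_def sum.If_cases)
qed

text \<open>The condition is a finite union, over sufficiently large index sets \<open>J\<close>
  below \<open>n\<close>, of the closed conditions that all \<open>x i\<close> with \<open>i\<close>
  in \<open>J\<close> lie in \<open>F\<close>.\<close>

lemma closed_hit_frequency:
  fixes F :: "'a::topological_space set"
  assumes "closed F"
  shows "closed {x. c \<le> hit_frequency n x F}"
proof -
  let ?J = "{J. J \<subseteq> {..<n} \<and> c \<le> real (card J) / real n}"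
  have iff: "c \<le> hit_frequency n x F \<longleftrightarrow> (\<exists>J\<in>?J. J \<subseteq> {i. x i \<in> F})" for x
  proof
    assume "c \<le> hit_frequency n x F"
    then show "\<exists>J\<in>?J. J \<subseteq> {i. x i \<in> F}"
      by (intro bexI[of _ "{i. i < n \<and> x i \<in> F}"]) (auto simp: hit_frequency_def)
  next
    assume "\<exists>J\<in>?J. J \<subseteq> {i. x i \<in> F}"
    then obtain J where J: "J \<subseteq> {..<n}" "c \<le> real (card J) / real n" "J \<subseteq> {i. x i \<in> F}"
      by blast
    then have "card J \<le> card {i. i < n \<and> x i \<in> F}" by (intro card_mono) auto
    then have "real (card J) / real n \<le> hit_frequency n x F"
      unfolding hit_frequency_def by (intro divide_right_mono) auto
    with J(2) show "c \<le> hit_frequency n x F" by linarith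
  qed
  have "{x. c \<le> hit_frequency n x F} = (\<Union>J\<in>?J. \<Inter>i\<in>J. (\<lambda>x. x i) -` F)"
    by (rule set_eqI) (simp add: iff subset_eq)
  also have "closed \<dots>"
  proof (intro closed_UN closed_INT ballI closed_vimage assms continuous_on_product_coordinates)
    show "finite ?J" by (rule finite_subset[of _ "Pow {..<n}"]) auto
  qed
  finally show ?thesis .
qed

section \<open>Concentration of hit frequencies for i.i.d. samples\<close>

lemma (in prob_space) indep_vars_coordinates:
  assumes "I \<noteq> {}"
  shows "prob_space.indep_vars (Pi\<^sub>M I (\<lambda>_. M)) (\<lambda>_. M) (\<lambda>i x. x i) I"
proof -
  interpret P: product_prob_space "\<lambda>_. M" I ..
  have "distr (Pi\<^sub>M I (\<lambda>_. M)) (Pi\<^sub>M I (\<lambda>_. M)) (\<lambda>x. \<lambda>i\<in>I. x i) = Pi\<^sub>M I (\<lambda>_. M)"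
    by (subst distr_cong[where g = "\<lambda>x. x"]) (auto simp: space_PiM distr_id2)
  moreover have "Pi\<^sub>M I (\<lambda>i. distr (Pi\<^sub>M I (\<lambda>_. M)) M (\<lambda>x. x i)) = Pi\<^sub>M I (\<lambda>_. M)"
    by (intro PiM_cong refl P.PiM_component)
  ultimately show ?thesis
    using assms by (subst P.P.indep_vars_iff_distr_eq_PiM') auto
qed

text \<open>Hoeffding's inequality for the i.i.d. indicators of the events that sample
  \<open>i\<close> lies in \<open>F\<close>.\<close>

lemma (in prob_space) hit_frequency_concentration:
  assumes F: "F \<in> events" and "n > 0" "e > 0"
  defines "P \<equiv> Pi\<^sub>M UNIV (\<lambda>_::nat. M)"
  shows "{x \<in> space P. prob F - e \<le> hit_frequency n x F} \<in> sets P"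
    and "1 - exp (- 2 * real n * e\<^sup>2) \<le> measure P {x \<in> space P. prob F - e \<le> hit_frequency n x F}"
proof -
  interpret P: product_prob_space "\<lambda>_. M" "UNIV :: nat set" ..
  interpret P': prob_space P unfolding P_def by unfold_locales
  have [measurable]: "(\<lambda>x. x i) \<in> measurable P M" for i
    unfolding P_def by measurable
  note F[measurable]
  define X :: "nat \<Rightarrow> (nat \<Rightarrow> 'a) \<Rightarrow> real" where "X = (\<lambda>i x. indicator F (x i))"
  have [measurable]: "X i \<in> borel_measurable P" for i unfolding X_def by measurable
  have distr: "distr P M (\<lambda>x. x i) = M" for i
    unfolding P_def using P.PiM_component[of i] by simp
  have "P'.indep_vars (\<lambda>_. M) (\<lambda>i x. x i) {..<n}"
    using P'.indep_vars_subset[OF indep_vars_coordinates[of "UNIV :: nat set", folded P_def]] by simp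
  then have indep: "P'.indep_vars (\<lambda>_. borel) X {..<n}"
    unfolding X_def by (rule P'.indep_vars_compose2) measurable
  have exp: "prob F = P'.expectation (X 0)"
  proof -
    have "P'.expectation (X 0) = (\<integral>y. indicator F y \<partial>distr P M (\<lambda>x. x 0))"
      unfolding X_def by (rule integral_distr[symmetric]) measurable
    then show ?thesis unfolding distr using F sets.sets_into_space by simp
  qed
  have distr_X: "distr P borel (X i) = distr P borel (X 0)" for i
  proof -
    have "distr P borel (X j) = distr (distr P M (\<lambda>x. x j)) borel (indicator F)" for j
      by (subst distr_distr) (auto simp: X_def comp_def)
    then show ?thesis by (simp add: distr)
  qed
  interpret H: Hoeffding_ineq_iid P "{..<n}" X "X 0" 0 1 "prob F"
  proof unfold_locales
    show "P'.indep_vars (\<lambda>_. borel) X {..<n}" by (rule indep)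
    show "distr P borel (X i) = distr P borel (X 0)" for i by (rule distr_X)
    show "X 0 \<in> borel_measurable P" by measurable
    show "AE x in P. X 0 x \<in> {0..1}" by (simp add: X_def indicator_def)
    show "prob F \<equiv> P'.expectation (X 0)" using exp by simp
  qed simp
  have eq: "hit_frequency n x F = (\<Sum>i<n. X i x) / real n" for x
    by (simp add: hit_frequency_sum X_def)
  show meas: "{x \<in> space P. prob F - e \<le> hit_frequency n x F} \<in> sets P"
    unfolding eq by measurable
  have "measure P (space P - {x \<in> space P. prob F - e \<le> hit_frequency n x F})
      \<le> measure P {x \<in> space P. (\<Sum>i<n. X i x) / real (card {..<n}) \<le> prob F - e}"
    by (intro P'.finite_measure_mono) (auto simp: eq)
  also have "\<dots> \<le> exp (- 2 * real n * e\<^sup>2)"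
    using H.Hoeffding_ineq_le'[of e] \<open>n > 0\<close> \<open>e > 0\<close> by (simp add: lessThan_empty_iff)
  finally show "1 - exp (- 2 * real n * e\<^sup>2)
      \<le> measure P {x \<in> space P. prob F - e \<le> hit_frequency n x F}"
    using P'.prob_compl[OF meas] by simp
qed

section \<open>Tightness and compact sets of equidistributed samples on Polish spaces\<close>

locale polish_prob_space = prob_space M for M :: "'a::metric_space measure" +
  fixes S :: "'a set"
  assumes sets_M: "sets M = sets (restrict_space borel (space M))"
    and complete_space: "complete (space M)"
    and countable_dense: "countable S" "S \<subseteq> space M" "space M \<subseteq> closure S"
begin

lemma borel_events: "B \<in> sets borel \<Longrightarrow> B \<inter> space M \<in> events"
  unfolding sets_M sets_restrict_space by (auto simp: Int_commute)

lemma cballs_cover: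
  assumes "x \<in> space M" "e > 0"
  shows "\<exists>s\<in>S. x \<in> cball s e"
proof -
  have "x \<in> closure S" using assms countable_dense by auto
  then show ?thesis
    using \<open>e > 0\<close> unfolding closure_approachable by (auto intro: less_imp_le)
qed

lemma increasing_prob_ge:
  assumes A: "\<And>i::nat. A i \<in> events" and mono: "\<And>i j. i \<le> j \<Longrightarrow> A i \<subseteq> A j" and "e > 0"
  shows "\<exists>i. prob (\<Union>i. A i) - e \<le> prob (A i)"
proof -
  have "(\<lambda>i. prob (A i)) \<longlonglongrightarrow> prob (\<Union>i. A i)"
    by (rule finite_Lim_measure_incseq) (use A mono in \<open>auto simp: incseq_def\<close>)
  then have "eventually (\<lambda>i. prob (\<Union>i. A i) - e < prob (A i)) sequentially"
    by (rule order_tendstoD) (use \<open>e > 0\<close> in simp)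
  then show ?thesis
    unfolding eventually_sequentially by (meson less_imp_le order_refl)
qed

lemma S_nonempty: "S \<noteq> {}"
  using cballs_cover[of _ 1] not_empty by auto

text \<open>Ulam's theorem. At each scale \<open>1 / Suc n\<close> finitely many closed balls around
  dense points capture all but \<open>e / 2 ^ Suc n\<close> of the mass; the intersection over all
  scales is complete and totally bounded.\<close>

lemma tight:
  assumes "e > 0"
  obtains K where "compact K" "K \<subseteq> space M" "K \<in> events" "1 - e \<le> prob K"
proof -
  define s where "s = from_nat_into S"
  have s: "range s = S"
    using S_nonempty countable_dense by (simp add: s_def range_from_nat_into)
  define B where "B n k = (\<Union>m\<le>k. cball (s m) (1 / Suc n)) \<inter> space M" for n k :: nat
  have B: "B n k \<in> events" for n k
    unfolding B_def by (intro borel_events borel_closed closed_UN) auto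
  have "(\<Union>k. B n k) = space M" for n
  proof -
    have "x \<in> (\<Union>k. B n k)" if x: "x \<in> space M" for x
    proof -
      obtain m where "x \<in> cball (s m) (1 / Suc n)"
        using cballs_cover[OF x, of "1 / Suc n"] s by fastforce
      with x show ?thesis unfolding B_def by (intro UN_I[of m]) auto
    qed
    then show ?thesis by (auto simp: B_def)
  qed
  moreover have "\<exists>k. prob (\<Union>k. B n k) - e * (1 / 2) ^ Suc n \<le> prob (B n k)" for n
  proof (rule increasing_prob_ge[OF B])
    show "B n i \<subseteq> B n j" if "i \<le> j" for i j
      unfolding B_def by (intro Int_mono UN_mono) (use that in auto)
  qed (use \<open>e > 0\<close> in simp)
  ultimately have "\<exists>k. 1 - e * (1 / 2) ^ Suc n \<le> prob (B n k)" for n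
    by (simp add: prob_space)
  then obtain k where k: "\<And>n. 1 - e * (1 / 2) ^ Suc n \<le> prob (B n (k n))" by metis
  define K where "K = (\<Inter>n. B n (k n))"
  have "1 - e \<le> prob K" unfolding K_def by (rule prob_INT_ge[OF B k])
  moreover have "K \<in> events" unfolding K_def using B by auto
  moreover have "K \<subseteq> space M" by (auto simp: K_def B_def)
  moreover have "compact K"
    unfolding compact_eq_totally_bounded
  proof (intro conjI allI impI)
    have "closed (\<Union>m\<le>k n. cball (s m) (1 / Suc n))" for n by (intro closed_UN) auto
    then have "complete (space M \<inter> (\<Inter>n. \<Union>m\<le>k n. cball (s m) (1 / Suc n)))"
      by (intro complete_Int_closed[OF complete_space] closed_INT) auto
    also have "space M \<inter> (\<Inter>n. \<Union>m\<le>k n. cball (s m) (1 / Suc n)) = K"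
      by (auto simp: K_def B_def)
    finally show "complete K" .
    fix r :: real assume "r > 0"
    then obtain n where n: "1 / real (Suc n) < r" by (rule nat_approx_posE)
    have "K \<subseteq> (\<Union>x\<in>s ` {..k n}. ball x r)"
    proof
      fix x assume "x \<in> K"
      then have "x \<in> B n (k n)" by (auto simp: K_def)
      then obtain m where "m \<le> k n" "dist (s m) x \<le> 1 / Suc n" by (auto simp: B_def)
      with n have "dist (s m) x < r" by linarith
      with \<open>m \<le> k n\<close> show "x \<in> (\<Union>x\<in>s ` {..k n}. ball x r)" by auto
    qed
    then show "\<exists>A. finite A \<and> K \<subseteq> (\<Union>x\<in>A. ball x r)"
      by (intro exI[of _ "s ` {..k n}"]) auto
  qed
  ultimately show ?thesis using that by blast
qed

text \<open>Closed balls around dense points that lie inside \<open>G\<close> cover \<open>G\<close>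
  within the space, and finitely many of them nearly exhaust its measure. Only countably many finite
  unions occur, which reduces equidistribution from all open sets to a sequence of closed
  ones.\<close>

lemma countable_closed_approximation:
  obtains F :: "nat \<Rightarrow> 'a set" where "\<And>k. closed (F k)"
    "\<And>G e. open G \<Longrightarrow> e > 0 \<Longrightarrow>
      \<exists>k. F k \<subseteq> G \<and> prob (G \<inter> space M) - e \<le> prob (F k \<inter> space M)"
proof -
  define b where "b = (\<lambda>(s :: 'a, n). cball s (1 / Suc n))"
  define I where "I = {X. finite X \<and> X \<subseteq> S \<times> (UNIV :: nat set)}"
  have "{} \<in> I" by (simp add: I_def)
  have "countable I"
    unfolding I_def using countable_dense by (intro countable_Collect_finite_subset) auto
  with \<open>{} \<in> I\<close> have I: "range (from_nat_into I) = I"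
    by (intro range_from_nat_into) auto
  define F where "F k = \<Union> (b ` from_nat_into I k)" for k
  have closed_b: "closed (b i)" for i by (cases i) (simp add: b_def)
  have "closed (F k)" for k
  proof -
    have "from_nat_into I k \<in> I" using I by blast
    then show ?thesis
      unfolding F_def using closed_b by (intro closed_Union) (auto simp: I_def)
  qed
  moreover have "\<exists>k. F k \<subseteq> G \<and> prob (G \<inter> space M) - e \<le> prob (F k \<inter> space M)"
    if G: "open G" and e: "e > 0" for G e
  proof -
    define C where "C = {i \<in> S \<times> UNIV. b i \<subseteq> G}"
    have cover: "\<exists>i\<in>C. x \<in> b i" if x: "x \<in> G" "x \<in> space M" for x
    proof -
      obtain r where r: "r > 0" "ball x r \<subseteq> G" using G x openE by blast
      then obtain n where n: "1 / real (Suc n) < r / 2" using nat_approx_posE[of "r / 2"] by auto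
      obtain s where s: "s \<in> S" "dist s x \<le> 1 / Suc n"
        using cballs_cover[OF x(2), of "1 / Suc n"] by auto
      have "cball s (1 / Suc n) \<subseteq> ball x r"
      proof
        fix y assume "y \<in> cball s (1 / Suc n)"
        then have "dist s y \<le> 1 / Suc n" by simp
        moreover have "dist x y \<le> dist s x + dist s y"
          using dist_triangle[of x y s] by (simp add: dist_commute)
        ultimately show "y \<in> ball x r" using s n by simp
      qed
      with r s show ?thesis by (intro bexI[of _ "(s, n)"]) (auto simp: C_def b_def)
    qed
    show ?thesis
    proof (cases "C = {}")
      \<comment> \<open>\<open>from_nat_into\<close> enumerates nonempty sets only, so this case is
        separate; the empty union does the job.\<close>
      case True
      then have "G \<inter> space M = {}" using cover by auto
      moreover obtain k where "from_nat_into I k = {}" using I \<open>{} \<in> I\<close> by (metis imageE)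
      ultimately show ?thesis using e by (intro exI[of _ k]) (auto simp: F_def)
    next
      case False
      define c where "c = from_nat_into C"
      have "countable C"
        using countable_dense by (auto simp: C_def intro!: countable_subset[OF _ countable_SIGMA[of S "\<lambda>_. UNIV"]])
      with False have c: "range c = C" by (simp add: c_def range_from_nat_into)
      define U where "U k = (\<Union>m\<le>k. b (c m)) \<inter> space M" for k :: nat
      have "\<exists>k. prob (\<Union>k. U k) - e \<le> prob (U k)"
      proof (rule increasing_prob_ge[OF _ _ e])
        show "U k \<in> events" for k
          unfolding U_def by (intro borel_events borel_closed closed_UN) (auto simp: closed_b)
        show "U i \<subseteq> U j" if "i \<le> j" for i j
          unfolding U_def by (intro Int_mono UN_mono) (use that in auto)
      qed
      then obtain k where k: "prob (\<Union>k. U k) - e \<le> prob (U k)" ..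
      have "(\<Union>k. U k) = G \<inter> space M"
      proof
        show "(\<Union>k. U k) \<subseteq> G \<inter> space M" using c by (auto simp: U_def C_def)
        show "G \<inter> space M \<subseteq> (\<Union>k. U k)"
        proof
          fix x assume x: "x \<in> G \<inter> space M"
          then obtain i where "i \<in> C" "x \<in> b i" using cover[of x] by blast
          with c obtain m where "x \<in> b (c m)" by auto
          with x have "x \<in> U m" by (auto simp: U_def)
          then show "x \<in> (\<Union>k. U k)" by blast
        qed
      qed
      moreover have "c ` {..k} \<in> I" using c by (auto simp: I_def C_def)
      then obtain l where l: "from_nat_into I l = c ` {..k}" using I by (metis imageE)
      then have "F l \<inter> space M = U k" "F l \<subseteq> G"
        using c by (auto simp: F_def U_def C_def)
      ultimately show ?thesis using k by auto
    qed
  qed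
  ultimately show ?thesis using that by blast
qed

text \<open>The compact set is a product of tight compact sets \<open>L m\<close>, cut down by the
  closed conditions that at time \<open>64 ^ m\<close> the sets \<open>F k\<close> with
  \<open>k < m\<close> are hit with the right frequency up to \<open>(1 / 2) ^ m\<close>. All
  failures together have probability at most 1/4.\<close>

lemma compact_equidistributed_samples:
  defines "P \<equiv> Pi\<^sub>M UNIV (\<lambda>_::nat. M)"
  obtains K where "compact K" "K \<in> sets P" "1 / 2 < measure P K" "\<And>x. x \<in> K \<Longrightarrow> equidistributed M x"
proof -
  interpret P: product_prob_space "\<lambda>_. M" "UNIV :: nat set" ..
  interpret P': prob_space P unfolding P_def by unfold_locales
  have space_P: "space P = {x. range x \<subseteq> space M}"
    by (auto simp: P_def space_PiM PiE_def Pi_def)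
  obtain F :: "nat \<Rightarrow> 'a set" where F: "\<And>k. closed (F k)"
    and approx: "\<And>G e. open G \<Longrightarrow> e > 0 \<Longrightarrow>
      \<exists>k. F k \<subseteq> G \<and> prob (G \<inter> space M) - e \<le> prob (F k \<inter> space M)"
    using countable_closed_approximation by metis
  have FM: "F k \<inter> space M \<in> events" for k
    by (intro borel_events borel_closed F)
  have "\<exists>K. compact K \<and> K \<subseteq> space M \<and> K \<in> events \<and> 1 - 1 / 8 * (1 / 2) ^ Suc m \<le> prob K" for m
    using tight[of "1 / 8 * (1 / 2) ^ Suc m"] by fastforce
  then obtain L where L: "\<And>m. compact (L m)" "\<And>m. L m \<subseteq> space M" "\<And>m. L m \<in> events"
    "\<And>m. 1 - 1 / 8 * (1 / 2) ^ Suc m \<le> prob (L m)" by metis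
  \<comment> \<open>\<open>H\<close> is the closed condition on arbitrary sequences,
    \<open>H'\<close> the measurable event with \<open>F k\<close> cut down to the space; they agree
    on \<open>space P\<close>.\<close>
  define H where "H m k = {x. prob (F k \<inter> space M) - (1 / 2) ^ m \<le> hit_frequency (64 ^ m) x (F k)}" for m k
  define H' where "H' m k = {x \<in> space P. prob (F k \<inter> space M) - (1 / 2) ^ m
    \<le> hit_frequency (64 ^ m) x (F k \<inter> space M)}" for m k
  have H'_eq: "H' m k = H m k \<inter> space P" for m k
    by (auto simp: H_def H'_def space_P hit_frequency_def image_subset_iff)
  have H': "H' m k \<in> sets P" for m k
    unfolding H'_def P_def by (rule hit_frequency_concentration(1)[OF FM]) auto
  \<comment> \<open>Tolerance \<open>(1 / 2) ^ m\<close> at time \<open>64 ^ m\<close> turns the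
    Hoeffding exponent into \<open>- 2 * 16 ^ m\<close>, which beats both the factor
    \<open>m\<close> from the union over \<open>k < m\<close> and the geometric weight.\<close>
  have tail: "real m * exp (- 2 * 64 ^ m * ((1 / 2) ^ m)\<^sup>2) \<le> 1 / 8 * (1 / 2) ^ Suc m" for m :: nat
  proof -
    have "(64 ^ m * ((1 / 2) ^ m)\<^sup>2 :: real) = (64 * (1 / 2)\<^sup>2) ^ m"
      by (simp only: power_mult_distrib power_mult[symmetric] mult.commute)
    then have exponent: "(64 ^ m * ((1 / 2) ^ m)\<^sup>2 :: real) = 16 ^ m"
      by (simp add: power2_eq_square)
    have "(16 ^ m :: real) \<le> exp (16 ^ m)"
      using exp_ge_add_one_self[of "16 ^ m"] by linarith
    then have "(16 ^ m * 16 ^ m :: real) \<le> exp (16 ^ m) * exp (16 ^ m)"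
      by (intro mult_mono) auto
    then have exp_ge: "(256 ^ m :: real) \<le> exp (2 * 16 ^ m)"
      by (simp add: power_mult_distrib[symmetric] exp_add[symmetric])
    have "m * 2 ^ m * 16 \<le> (256 :: nat) ^ m"
    proof (cases m)
      case (Suc l)
      have "m * 2 ^ m * 16 \<le> 2 ^ m * 2 ^ m * 16"
        using less_exp[of m] by simp
      also have "\<dots> \<le> 2 ^ m * 2 ^ m * 64 ^ m"
        using Suc self_le_power[of "64 :: nat" m] by simp
      finally show ?thesis by (simp add: power_mult_distrib[symmetric])
    qed simp
    then have "real (m * 2 ^ m * 16) \<le> real (256 ^ m)"
      by (rule of_nat_mono)
    then have "real m * 2 ^ m * 16 \<le> exp (2 * 16 ^ m)" using exp_ge by simp
    moreover have "- 2 * 64 ^ m * ((1 / 2) ^ m)\<^sup>2 = - (2 * 16 ^ m :: real)"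
      by (simp only: mult.assoc exponent mult_minus_left)
    ultimately show ?thesis
      by (simp only: exp_minus) (simp add: field_simps)
  qed
  define V where "V m = {x \<in> space P. x m \<in> L m}" for m
  have V: "V m \<in> sets P" for m
    unfolding V_def P_def using L(3) by measurable
  have V_prob: "measure P (V m) = prob (L m)" for m
    unfolding V_def P_def using P.emeasure_PiM_Collect_single[of m "L m"] L(3)
    by (simp add: measure_def)
  define E where "E m = V m \<inter> (\<Inter>k<m. H' m k) \<inter> space P" for m
  have E: "E m \<in> sets P" for m
    using V H' by (cases "m = 0") (auto simp: E_def intro!: sets.finite_INT)
  have "1 - 1 / 4 * (1 / 2) ^ Suc m \<le> measure P (E m)" for m
  proof -
    have "space P - E m \<subseteq> (space P - V m) \<union> (\<Union>k<m. space P - H' m k)"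
      by (auto simp: E_def)
    moreover have UN: "(\<Union>k<m. space P - H' m k) \<in> sets P"
      by (intro sets.finite_UN sets.compl_sets H') simp
    ultimately have "measure P (space P - E m) \<le> measure P ((space P - V m) \<union> (\<Union>k<m. space P - H' m k))"
      using V by (intro P'.finite_measure_mono sets.Un) auto
    also have "\<dots> \<le> measure P (space P - V m) + measure P (\<Union>k<m. space P - H' m k)"
      using V UN by (intro measure_Un_le) auto
    also have "measure P (\<Union>k<m. space P - H' m k) \<le> (\<Sum>k<m. measure P (space P - H' m k))"
      using H' by (intro P'.finite_measure_subadditive_finite) auto
    also have "\<dots> \<le> (\<Sum>k<m. exp (- 2 * 64 ^ m * ((1 / 2) ^ m)\<^sup>2))"
    proof (rule sum_mono)
      fix k
      have "1 - exp (- 2 * real (64 ^ m) * ((1 / 2) ^ m)\<^sup>2) \<le> measure P (H' m k)"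
        unfolding H'_def P_def by (rule hit_frequency_concentration(2)[OF FM]) auto
      then show "measure P (space P - H' m k) \<le> exp (- 2 * 64 ^ m * ((1 / 2) ^ m)\<^sup>2)"
        using P'.prob_compl[OF H'] by simp
    qed
    also have "\<dots> \<le> 1 / 8 * (1 / 2) ^ Suc m" using tail[of m] by simp
    finally have "measure P (space P - E m) \<le> measure P (space P - V m) + 1 / 8 * (1 / 2) ^ Suc m"
      by simp
    moreover have "measure P (space P - V m) \<le> 1 / 8 * (1 / 2) ^ Suc m"
      using P'.prob_compl[OF V] V_prob L(4)[of m] by simp
    ultimately show ?thesis using P'.prob_compl[OF E, of m] by simp
  qed
  then have prob: "1 - 1 / 4 \<le> measure P (\<Inter>m. E m)"
    by (rule P'.prob_INT_ge[OF E])
  define K where "K = (\<Inter>m. E m)"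
  \<comment> \<open>Measurability and probability come from the events \<open>E m\<close>; this
    second description shows \<open>K\<close> as a compact product intersected with a closed
    set.\<close>
  have K_eq: "K = Pi\<^sub>E UNIV L \<inter> (\<Inter>m. \<Inter>k<m. H m k)"
  proof (rule set_eqI)
    fix x
    have "x \<in> space P" if "\<forall>m. x m \<in> L m"
      using that L(2) by (auto simp: space_P)
    then show "x \<in> K \<longleftrightarrow> x \<in> Pi\<^sub>E UNIV L \<inter> (\<Inter>m. \<Inter>k<m. H m k)"
      by (auto simp: K_def E_def V_def H'_eq PiE_iff)
  qed
  show ?thesis
  proof (rule that)
    have "compactin (product_topology (\<lambda>_. euclidean) UNIV) (Pi\<^sub>E UNIV L)"
      using L(1) by (simp add: compactin_PiE)
    then have "compact (Pi\<^sub>E UNIV L)" by (simp add: euclidean_product_topology)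
    moreover have "closed (\<Inter>m. \<Inter>k<m. H m k)"
      unfolding H_def by (intro closed_INT ballI closed_hit_frequency F)
    ultimately show "compact K" unfolding K_eq by (rule compact_Int_closed)
    show "K \<in> sets P" unfolding K_def using E by auto
    show "1 / 2 < measure P K" using prob unfolding K_def by simp
    fix x assume x: "x \<in> K"
    have freq: "prob (F k \<inter> space M) - (1 / 2) ^ m \<le> hit_frequency (64 ^ m) x (F k)" if "k < m" for k m
      using x that by (auto simp: K_eq H_def)
    show "equidistributed M x"
      unfolding equidistributed_def
    proof (intro conjI allI impI)
      show "range x \<subseteq> space M" using x by (auto simp: K_def E_def space_P)
      fix G :: "'a set" and e :: real assume "open G" "e > 0"
      then obtain k where k: "F k \<subseteq> G" "prob (G \<inter> space M) - e / 2 \<le> prob (F k \<inter> space M)"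
        using approx[of G "e / 2"] by auto
      obtain N where N: "(1 / 2) ^ N < e / 2"
        using real_arch_pow_inv[of "e / 2" "1 / 2"] \<open>e > 0\<close> by auto
      \<comment> \<open>Half of \<open>e\<close> pays for replacing \<open>G\<close> by
        \<open>F k\<close>, the other half for the tolerance \<open>(1 / 2) ^ m\<close>. Times
        beyond \<open>Suc k\<close> are required because \<open>F k\<close> is controlled only when
        \<open>k < m\<close>.\<close>
      show "\<exists>N. \<forall>m\<ge>N. prob (G \<inter> space M) - e \<le> hit_frequency (64 ^ m) x G"
      proof (intro exI allI impI)
        fix m assume m: "max N (Suc k) \<le> m"
        then have "k < m" by simp
        have "(1 / 2 :: real) ^ m \<le> (1 / 2) ^ N" using m by (intro power_decreasing) auto
        then show "prob (G \<inter> space M) - e \<le> hit_frequency (64 ^ m) x G"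
          using freq[OF \<open>k < m\<close>] hit_frequency_mono[OF k(1), of "64 ^ m" x] k(2) m N by linarith
      qed
    qed
  qed
qed

end

subsection \<open>Uniqueness of weak limits\<close>

text \<open>Products of truncated multiples of the distance to the complements are bounded,
  continuous, and converge pointwise to the indicator of an open box. By dominated convergence the
  measures agree on boxes, which are stable under intersection and generate the algebra.\<close>

lemma finite_product_measure_eqI_continuous:
  fixes N N' :: "('i \<Rightarrow> real) measure"
  assumes I: "finite I"
    and N: "finite_measure N" "sets N = sets (Pi\<^sub>M I (\<lambda>_. borel))"
    and N': "finite_measure N'" "sets N' = sets (Pi\<^sub>M I (\<lambda>_. borel))"
    and eq: "\<And>f B. continuous_map (product_topology (\<lambda>_. euclideanreal) I) euclideanreal f \<Longrightarrow>
      (\<And>x. \<bar>f x\<bar> \<le> B) \<Longrightarrow> (\<integral>x. f x \<partial>N) = (\<integral>x. f x \<partial>N')"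
  shows "N = N'"
proof -
  \<comment> \<open>These are the open boxes, written in the shape that
    \<open>sets_PiM_sigma\<close> produces.\<close>
  define E where "E = {{f \<in> Pi\<^sub>E I (\<lambda>_. UNIV). \<forall>i\<in>j. f i \<in> A i} |A j. j \<in> {I} \<and> A \<in> Pi j (\<lambda>_. {S :: real set. open S})}"
  have E: "X \<in> E \<longleftrightarrow> (\<exists>U. (\<forall>i\<in>I. open (U i)) \<and> X = Pi\<^sub>E I U)" for X
    by (auto simp: E_def PiE_def Pi_def)
  have gen: "sets (Pi\<^sub>M I (\<lambda>_. borel :: real measure)) = sigma_sets (Pi\<^sub>E I (\<lambda>_. UNIV)) E"
  proof -
    have "sets (Pi\<^sub>M I (\<lambda>_. sigma UNIV {S :: real set. open S})) = sets (sigma (Pi\<^sub>E I (\<lambda>_. UNIV)) E)"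
      unfolding E_def
    proof (rule sets_PiM_sigma)
      show "\<exists>S\<subseteq>{S :: real set. open S}. countable S \<and> UNIV = \<Union>S" for i
        by (rule exI[of _ "{UNIV}"]) auto
    qed (use I in auto)
    also have "E \<subseteq> Pow (Pi\<^sub>E I (\<lambda>_. UNIV))" by (auto simp: E_def)
    then have "sets (sigma (Pi\<^sub>E I (\<lambda>_. UNIV)) E) = sigma_sets (Pi\<^sub>E I (\<lambda>_. UNIV)) E" by simp
    finally show ?thesis by (simp add: borel_def)
  qed
  \<comment> \<open>The full line is treated apart because \<open>infdist\<close> to the empty set
    is 0 by convention.\<close>
  define h :: "nat \<Rightarrow> real set \<Rightarrow> real \<Rightarrow> real" where
    "h n U t = (if U = UNIV then 1 else min 1 (real n * infdist t (- U)))" for n U t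
  have h_cont: "continuous_on UNIV (h n U)" for n U
    by (cases "U = UNIV") (auto simp: h_def intro!: continuous_intros)
  have h_bound: "0 \<le> h n U t" "h n U t \<le> 1" for n U t
    by (auto simp: h_def infdist_nonneg)
  have h_lim: "(\<lambda>n. h n U t) \<longlonglongrightarrow> indicator U t" if U: "open U" for U t
  proof (cases "t \<in> U \<and> U \<noteq> UNIV")
    case True
    then have "infdist t (- U) > 0"
      using infdist_pos_not_in_closed[of "- U" t] U by auto
    then obtain N where "1 < real N * infdist t (- U)"
      using reals_Archimedean3 by blast
    then have "1 \<le> real n * infdist t (- U)" if "n \<ge> N" for n
      using that by (smt (verit) infdist_nonneg mult_right_mono of_nat_le_iff)
    then have "eventually (\<lambda>n. h n U t = 1) sequentially"
      unfolding eventually_sequentially using True by (auto simp: h_def intro!: exI[of _ N])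
    then show ?thesis using True by (simp add: tendsto_eventually)
  next
    case False
    then have "h n U t = indicator U t" for n
      by (auto simp: h_def)
    then show ?thesis by simp
  qed
  define g where "g n U x = (\<Prod>i\<in>I. h n (U i) (x i))" for n U and x :: "'i \<Rightarrow> real"
  have g_bound: "\<bar>g n U x\<bar> \<le> 1" for n U x
    unfolding g_def abs_prod using h_bound by (intro prod_le_1) auto
  have box: "(\<lambda>n. \<integral>x. g n U x \<partial>L) \<longlonglongrightarrow> measure L (Pi\<^sub>E I U)"
    if L: "finite_measure L" "sets L = sets (Pi\<^sub>M I (\<lambda>_. borel))" and U: "\<forall>i\<in>I. open (U i)" for L U
  proof -
    interpret finite_measure L by fact
    have space: "space L = Pi\<^sub>E I (\<lambda>_. UNIV)"
      using sets_eq_imp_space_eq[OF L(2)] by (simp add: space_PiM)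
    have box_sets: "Pi\<^sub>E I U \<in> sets L"
      unfolding L(2) using U I by (intro sets_PiM_I_finite) auto
    have "(\<lambda>n. \<integral>x. g n U x \<partial>L) \<longlonglongrightarrow> (\<integral>x. indicator (Pi\<^sub>E I U) x \<partial>L)"
    proof (rule integral_dominated_convergence[where w = "\<lambda>_. 1"])
      have [measurable]: "h n V \<in> borel_measurable borel" for n V
        using h_cont by (rule borel_measurable_continuous_onI)
      show "g n U \<in> borel_measurable L" for n
        unfolding g_def measurable_cong_sets[OF L(2) refl] by measurable
      show "indicator (Pi\<^sub>E I U) \<in> borel_measurable L"
        using box_sets by (rule borel_measurable_indicator)
      show "AE x in L. (\<lambda>n. g n U x) \<longlonglongrightarrow> indicator (Pi\<^sub>E I U) x"
      proof (rule AE_I2)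
        fix x assume x: "x \<in> space L"
        have "(\<lambda>n. g n U x) \<longlonglongrightarrow> (\<Prod>i\<in>I. indicator (U i) (x i))"
          unfolding g_def using U by (intro tendsto_prod h_lim) auto
        also have "(\<Prod>i\<in>I. indicator (U i) (x i)) = (indicator (Pi\<^sub>E I U) x :: real)"
          using x I by (auto simp: indicator_def space PiE_iff)
        finally show "(\<lambda>n. g n U x) \<longlonglongrightarrow> indicator (Pi\<^sub>E I U) x" .
      qed
    qed (use g_bound in auto)
    then show ?thesis using box_sets by simp
  qed
  have "emeasure N X = emeasure N' X" if "X \<in> E" for X
  proof -
    from that obtain U where U: "\<forall>i\<in>I. open (U i)" and X: "X = Pi\<^sub>E I U" using E by auto
    have "(\<integral>x. g n U x \<partial>N) = (\<integral>x. g n U x \<partial>N')" for n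
    proof (rule eq[OF _ g_bound])
      have "continuous_map (product_topology (\<lambda>_. euclideanreal) I) euclideanreal (\<lambda>x. h n (U i) (x i))"
        if "i \<in> I" for i
        using continuous_map_compose[OF continuous_map_product_projection[OF that, of "\<lambda>_. euclideanreal"],
            of euclideanreal "h n (U i)"] h_cont
        by (simp add: comp_def continuous_map_iff_continuous2)
      then show "continuous_map (product_topology (\<lambda>_. euclideanreal) I) euclideanreal (g n U)"
        unfolding g_def using I by (intro continuous_map_prod) auto
    qed
    with box[OF N U] box[OF N' U] have "measure N X = measure N' X"
      using LIMSEQ_unique X by auto
    then show ?thesis
      using N(1) N'(1) by (simp add: finite_measure.emeasure_eq_measure)
  qed
  then show ?thesis
  proof (rule measure_eqI_generator_eq[rotated 2])
    show "Int_stable E"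
    proof (rule Int_stableI)
      fix a b assume "a \<in> E" "b \<in> E"
      then obtain U V where "\<forall>i\<in>I. open (U i)" "a = Pi\<^sub>E I U" "\<forall>i\<in>I. open (V i)" "b = Pi\<^sub>E I V"
        unfolding E by auto
      then have "\<forall>i\<in>I. open (U i \<inter> V i)" "a \<inter> b = Pi\<^sub>E I (\<lambda>i. U i \<inter> V i)"
        by (auto simp: PiE_Int)
      then show "a \<inter> b \<in> E" unfolding E by auto
    qed
    show "E \<subseteq> Pow (Pi\<^sub>E I (\<lambda>_. UNIV))" by (auto simp: E_def)
    show "sets N = sigma_sets (Pi\<^sub>E I (\<lambda>_. UNIV)) E" "sets N' = sigma_sets (Pi\<^sub>E I (\<lambda>_. UNIV)) E"
      using N N' gen by auto
    show "range (\<lambda>_::nat. Pi\<^sub>E I (\<lambda>_. UNIV)) \<subseteq> E" unfolding image_subset_iff E by auto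
    show "emeasure N (Pi\<^sub>E I (\<lambda>_. UNIV)) \<noteq> \<infinity>" for i :: nat
      using N(1) by (simp add: finite_measure.emeasure_finite)
  qed auto
qed

lemma weak_limit_unique:
  assumes lim: "weakly_converges (matrix_topology r) X N" "weakly_converges (matrix_topology r) X N'"
    and N: "finite_measure N" "sets N = sets (Pi\<^sub>M ({1..r} \<times> {1..r}) (\<lambda>_. borel))"
    and N': "finite_measure N'" "sets N' = sets (Pi\<^sub>M ({1..r} \<times> {1..r}) (\<lambda>_. borel))"
  shows "N = N'"
proof (rule finite_product_measure_eqI_continuous[OF _ N N'])
  fix f B
  assume "continuous_map (product_topology (\<lambda>_. euclideanreal) ({1..r} \<times> {1..r})) euclideanreal f"
    "\<And>x. \<bar>f x\<bar> \<le> B"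
  then have "continuous_map (matrix_topology r) euclideanreal f \<and>
      (\<exists>B. \<forall>x\<in>topspace (matrix_topology r). \<bar>f x\<bar> \<le> B)"
    by (auto simp: matrix_topology_def)
  with lim show "(\<integral>x. f x \<partial>N) = (\<integral>x. f x \<partial>N')"
    unfolding weakly_converges_def by (meson LIMSEQ_unique)
qed simp

subsection \<open>The law of the infinite distance matrix\<close>

lemma sampling_map_measurable:
  assumes D: "long_dendron T \<nu>"
  shows "sampling_map r dendron_dist \<in> measurable (Pi\<^sub>M {1..r} (\<lambda>_. \<nu>)) (Pi\<^sub>M ({1..r} \<times> {1..r}) (\<lambda>_. borel))"
  unfolding sampling_map_def
proof (rule measurable_restrict)
  fix p assume "p \<in> {1..r} \<times> {1..r}"
  then have "fst p \<in> {1..r}" "snd p \<in> {1..r}" by auto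
  then show "(\<lambda>x. (case p of (i, j) \<Rightarrow> if i = j then 0 else dendron_dist (x i) (x j)))
      \<in> borel_measurable (Pi\<^sub>M {1..r} (\<lambda>_. \<nu>))"
    by (cases "fst p = snd p")
      (auto simp: case_prod_beta intro!: dendron_dist_measurable[OF D] measurable_component_singleton)
qed

lemma sets_dendron_sampling:
  "sets (dendron_sampling r \<nu>) = sets (Pi\<^sub>M ({1..r} \<times> {1..r}) (\<lambda>_. borel))"
  by (simp add: dendron_sampling_def sampling_measure_def)

lemma prob_space_dendron_sampling:
  assumes D: "long_dendron T \<nu>"
  shows "prob_space (dendron_sampling r \<nu>)"
  unfolding dendron_sampling_def sampling_measure_def
  by (rule prob_space.prob_space_distr[OF prob_space_PiM sampling_map_measurable[OF D]])
    (use long_dendron_sets[OF D] in simp)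

text \<open>The infinite analogue of \<open>sampling_map\<close>. Indices start at 0 here and at 1
  there, hence the shifts by \<open>Suc\<close> when the two are compared.\<close>

definition sample_matrix :: "(nat \<Rightarrow> 'a::metric_space \<times> real) \<Rightarrow> nat \<times> nat \<Rightarrow> real" where
  "sample_matrix x = (\<lambda>(i, j). if i = j then 0 else dendron_dist (x i) (x j))"

definition matrix_law :: "('a::metric_space \<times> real) measure \<Rightarrow> (nat \<times> nat \<Rightarrow> real) measure" where
  "matrix_law \<nu> = distr (Pi\<^sub>M UNIV (\<lambda>_. \<nu>)) (Pi\<^sub>M UNIV (\<lambda>_. borel)) sample_matrix"

lemma sample_matrix_measurable:
  assumes D: "long_dendron T \<nu>"
  shows "sample_matrix \<in> measurable (Pi\<^sub>M UNIV (\<lambda>_. \<nu>)) (Pi\<^sub>M UNIV (\<lambda>_. borel))"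
proof (rule measurable_PiM_single')
  fix p :: "nat \<times> nat"
  show "(\<lambda>x. sample_matrix x p) \<in> borel_measurable (Pi\<^sub>M UNIV (\<lambda>_. \<nu>))"
    by (cases "fst p = snd p")
      (auto simp: sample_matrix_def case_prod_beta
        intro!: dendron_dist_measurable[OF D] measurable_component_singleton)
qed auto

lemma sample_matrix_continuous: "continuous_on UNIV (sample_matrix :: (nat \<Rightarrow> 'a::metric_space \<times> real) \<Rightarrow> _)"
proof (rule continuous_on_coordinatewise_then_product)
  fix p :: "nat \<times> nat"
  have "continuous_on UNIV (\<lambda>x. dendron_dist (x (fst p)) (x (snd p)))"
    unfolding dendron_dist_def by (intro continuous_intros continuous_on_product_coordinates)
  then show "continuous_on UNIV (\<lambda>x :: nat \<Rightarrow> 'a \<times> real. sample_matrix x p)"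
    by (cases "fst p = snd p") (auto simp: sample_matrix_def case_prod_beta)
qed

text \<open>A cylinder event with indices below \<open>r\<close> involves only the first
  \<open>r\<close> samples, and these, renumbered, are again i.i.d. with law \<open>\<nu>\<close>.
  Finite-dimensional marginals of the infinite law are thus read off from the sampling measure of
  order \<open>r\<close>.\<close>

lemma emeasure_matrix_law:
  assumes D: "long_dendron T \<nu>" and J: "finite J" "J \<subseteq> {..<r} \<times> {..<r}" and A: "\<And>p. p \<in> J \<Longrightarrow> A p \<in> sets borel"
  shows "emeasure (matrix_law \<nu>) (prod_emb UNIV (\<lambda>_. borel) J (Pi\<^sub>E J A)) =
    emeasure (dendron_sampling r \<nu>)
      {m \<in> space (Pi\<^sub>M ({1..r} \<times> {1..r}) (\<lambda>_. borel)). \<forall>p\<in>J. m (Suc (fst p), Suc (snd p)) \<in> A p}"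
    (is "_ = emeasure _ ?Y")
proof -
  let ?P = "Pi\<^sub>M UNIV (\<lambda>_::nat. \<nu>)" and ?Q = "Pi\<^sub>M {1..r} (\<lambda>_. \<nu>)"
  \<comment> \<open>Renumbers samples 0 to \<open>r - 1\<close> as 1 to \<open>r\<close>.\<close>
  let ?t = "\<lambda>x. \<lambda>n\<in>{1..r}. x (n - 1)"
  have prob: "prob_space \<nu>" using long_dendron_sets[OF D] by simp
  have reindex: "distr ?P ?Q ?t = ?Q"
    using prob by (intro distr_PiM_reindex[of UNIV "\<lambda>_. \<nu>" "\<lambda>n. n - 1" "{1..r}"])
      (auto simp: inj_on_def)
  have t: "?t \<in> measurable ?P ?Q"
    by (intro measurable_restrict measurable_component_singleton) auto
  have JS: "(Suc (fst p), Suc (snd p)) \<in> {1..r} \<times> {1..r}" if "p \<in> J" for p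
    using J that by auto
  have Y: "?Y \<in> sets (Pi\<^sub>M ({1..r} \<times> {1..r}) (\<lambda>_. borel))"
  proof -
    have "{m \<in> space (Pi\<^sub>M ({1..r} \<times> {1..r}) (\<lambda>_. borel)). m (Suc (fst p), Suc (snd p)) \<in> A p}
        \<in> sets (Pi\<^sub>M ({1..r} \<times> {1..r}) (\<lambda>_. borel))" if "p \<in> J" for p
      using JS[OF that] A[OF that] by measurable
    then show ?thesis
      using J(1) by (rule sets.sets_Collect_finite_All)
  qed
  have X: "prod_emb UNIV (\<lambda>_. borel :: real measure) J (Pi\<^sub>E J A) \<in> sets (Pi\<^sub>M UNIV (\<lambda>_. borel))"
    using J A by (intro sets_PiM_I) auto
  have "emeasure (dendron_sampling r \<nu>) ?Y =
      emeasure ?Q (sampling_map r dendron_dist -` ?Y \<inter> space ?Q)"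
    unfolding dendron_sampling_def sampling_measure_def
    by (rule emeasure_distr[OF sampling_map_measurable[OF D] Y])
  also have "\<dots> = emeasure (distr ?P ?Q ?t) (sampling_map r dendron_dist -` ?Y \<inter> space ?Q)"
    by (simp only: reindex)
  also have "\<dots> = emeasure ?P (?t -` (sampling_map r dendron_dist -` ?Y \<inter> space ?Q) \<inter> space ?P)"
    by (rule emeasure_distr[OF t measurable_sets[OF sampling_map_measurable[OF D] Y]])
  also have "?t -` (sampling_map r dendron_dist -` ?Y \<inter> space ?Q) \<inter> space ?P =
      sample_matrix -` prod_emb UNIV (\<lambda>_. borel) J (Pi\<^sub>E J A) \<inter> space ?P"
  proof (rule set_eqI)
    fix x
    show "x \<in> ?t -` (sampling_map r dendron_dist -` ?Y \<inter> space ?Q) \<inter> space ?P \<longleftrightarrow>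
      x \<in> sample_matrix -` prod_emb UNIV (\<lambda>_. borel) J (Pi\<^sub>E J A) \<inter> space ?P"
    proof (cases "x \<in> space ?P")
      case True
      then have tx: "?t x \<in> space ?Q" using measurable_space[OF t] by auto
      have "sampling_map r dendron_dist (?t x) (Suc (fst p), Suc (snd p)) = sample_matrix x p"
        if "p \<in> J" for p
        using JS[OF that] by (auto simp: sampling_map_def sample_matrix_def case_prod_beta)
      then have "sampling_map r dendron_dist (?t x) \<in> ?Y \<longleftrightarrow> (\<forall>p\<in>J. sample_matrix x p \<in> A p)"
        using measurable_space[OF sampling_map_measurable[OF D] tx] by auto
      moreover have "sample_matrix x \<in> prod_emb UNIV (\<lambda>_. borel) J (Pi\<^sub>E J A) \<longleftrightarrow>
          (\<forall>p\<in>J. sample_matrix x p \<in> A p)"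
        by (auto simp: prod_emb_def PiE_iff)
      ultimately show ?thesis using True tx by auto
    qed auto
  qed
  also have "emeasure ?P (sample_matrix -` prod_emb UNIV (\<lambda>_. borel) J (Pi\<^sub>E J A) \<inter> space ?P) =
      emeasure (matrix_law \<nu>) (prod_emb UNIV (\<lambda>_. borel) J (Pi\<^sub>E J A))"
    unfolding matrix_law_def by (rule emeasure_distr[OF sample_matrix_measurable[OF D] X, symmetric])
  finally show ?thesis ..
qed

lemma prob_space_matrix_law:
  assumes D: "long_dendron T \<nu>"
  shows "prob_space (matrix_law \<nu>)"
  unfolding matrix_law_def
  by (rule prob_space.prob_space_distr[OF prob_space_PiM sample_matrix_measurable[OF D]])
    (use long_dendron_sets[OF D] in simp)

lemma matrix_law_eqI:
  assumes D: "long_dendron T \<nu>" and D': "long_dendron T' \<nu>'"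
    and eq: "\<And>r. r \<ge> 1 \<Longrightarrow> dendron_sampling r \<nu> = dendron_sampling r \<nu>'"
  shows "matrix_law \<nu> = matrix_law \<nu>'"
proof (rule measure_eqI_PiM_infinite)
  show "sets (matrix_law \<nu>) = sets (Pi\<^sub>M UNIV (\<lambda>_. borel))"
    "sets (matrix_law \<nu>') = sets (Pi\<^sub>M UNIV (\<lambda>_. borel))" by (simp_all add: matrix_law_def)
  show "finite_measure (matrix_law \<nu>)"
    using prob_space_matrix_law[OF D] by (simp add: prob_space_def)
  fix A :: "nat \<times> nat \<Rightarrow> real set" and J
  assume J: "finite J" and A: "\<And>i. i \<in> J \<Longrightarrow> A i \<in> sets borel"
  \<comment> \<open>Inserting 0 keeps the maximum meaningful for empty \<open>J\<close>;
    \<open>Suc\<close> puts every index strictly below \<open>r\<close> and ensures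
    \<open>r \<ge> 1\<close>.\<close>
  define r where "r = Suc (Max (insert 0 (fst ` J \<union> snd ` J)))"
  have "J \<subseteq> {..<r} \<times> {..<r}"
  proof
    fix p assume "p \<in> J"
    then have "fst p \<le> Max (insert 0 (fst ` J \<union> snd ` J))" "snd p \<le> Max (insert 0 (fst ` J \<union> snd ` J))"
      using J by (auto intro!: Max_ge)
    then show "p \<in> {..<r} \<times> {..<r}" by (cases p) (simp add: r_def)
  qed
  with J A show "emeasure (matrix_law \<nu>) (prod_emb UNIV (\<lambda>_. borel) J (Pi\<^sub>E J A)) =
      emeasure (matrix_law \<nu>') (prod_emb UNIV (\<lambda>_. borel) J (Pi\<^sub>E J A))"
    using eq[of r] by (simp add: emeasure_matrix_law[OF D] emeasure_matrix_law[OF D'] r_def)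
qed

section \<open>Equidistributed samples of two dendrons with a common matrix\<close>

lemma complete_Times:
  fixes A :: "'a::metric_space set" and B :: "'b::metric_space set"
  assumes "complete A" "complete B"
  shows "complete (A \<times> B)"
proof (rule completeI)
  fix f :: "nat \<Rightarrow> 'a \<times> 'b" assume f: "\<forall>n. f n \<in> A \<times> B" and "Cauchy f"
  then have "Cauchy (\<lambda>n. fst (f n))" "Cauchy (\<lambda>n. snd (f n))"
    unfolding Cauchy_def by (meson dist_fst_le dist_snd_le le_less_trans)+
  moreover have "\<forall>n. fst (f n) \<in> A" "\<forall>n. snd (f n) \<in> B" using f by (auto simp: mem_Times_iff)
  ultimately obtain a b where "a \<in> A" "(\<lambda>n. fst (f n)) \<longlonglongrightarrow> a" "b \<in> B" "(\<lambda>n. snd (f n)) \<longlonglongrightarrow> b"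
    using assms unfolding complete_def by meson
  then show "\<exists>l\<in>A \<times> B. f \<longlonglongrightarrow> l"
    using tendsto_Pair[of "\<lambda>n. fst (f n)" a _ "\<lambda>n. snd (f n)" b] by (intro bexI[of _ "(a, b)"]) auto
qed

lemma long_dendron_polish:
  assumes D: "long_dendron T \<nu>"
  obtains S where "polish_prob_space \<nu> S"
proof -
  note sp = long_dendron_sets[OF D]
  obtain S where S: "countable S" "S \<subseteq> T" "T \<subseteq> closure S"
    using long_dendron_separable[OF D] .
  interpret prob_space \<nu> by (rule sp)
  have "complete T" using sp(3) by (simp add: real_tree_def)
  then have compl: "complete (T \<times> {0::real..})"
    by (intro complete_Times) (simp_all add: complete_eq_closed)
  have dense: "{0..} \<subseteq> closure (\<rat> \<inter> {0::real..})"
  proof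
    fix x :: real assume "x \<in> {0..}"
    have "\<exists>y\<in>\<rat> \<inter> {0..}. dist y x < e" if "e > 0" for e
    proof -
      obtain q where "q \<in> \<rat>" "x < q" "q < x + e"
        using Rats_dense_in_real[of x "x + e"] \<open>e > 0\<close> by auto
      with \<open>x \<in> {0..}\<close> show ?thesis by (intro bexI[of _ q]) (auto simp: dist_real_def)
    qed
    then show "x \<in> closure (\<rat> \<inter> {0..})" by (simp add: closure_approachable)
  qed
  have "polish_prob_space \<nu> (S \<times> (\<rat> \<inter> {0..}))"
  proof unfold_locales
    show "sets \<nu> = sets (restrict_space borel (space \<nu>))" using sp by simp
    show "complete (space \<nu>)" using sp compl by simp
    show "countable (S \<times> (\<rat> \<inter> {0::real..}))"
      using S(1) countable_rat by (intro countable_SIGMA) (auto intro: countable_subset)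
    show "S \<times> (\<rat> \<inter> {0..}) \<subseteq> space \<nu>" using S sp by auto
    show "space \<nu> \<subseteq> closure (S \<times> (\<rat> \<inter> {0..}))"
      unfolding sp(2) closure_Times using S(3) dense by auto
  qed
  then show ?thesis using that by blast
qed

text \<open>A continuous image of a compact set is compact, hence closed and measurable, and its
  preimage contains \<open>K\<close>, so no probability is lost.\<close>

lemma compact_matrices_of_equidistributed_samples:
  assumes D: "long_dendron T \<nu>"
  obtains K where "compact (sample_matrix ` K)" "1 / 2 < measure (matrix_law \<nu>) (sample_matrix ` K)"
    "\<And>x. x \<in> K \<Longrightarrow> equidistributed \<nu> x"
proof -
  obtain S where "polish_prob_space \<nu> S" using long_dendron_polish[OF D] .
  then interpret polish_prob_space \<nu> S .
  let ?P = "Pi\<^sub>M UNIV (\<lambda>_::nat. \<nu>)"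
  interpret P: prob_space ?P by (intro prob_space_PiM) unfold_locales
  obtain K where K: "compact K" "K \<in> sets ?P" "1 / 2 < measure ?P K" "\<And>x. x \<in> K \<Longrightarrow> equidistributed \<nu> x"
    using compact_equidistributed_samples by metis
  have cpt: "compact (sample_matrix ` K)"
    by (intro compact_continuous_image continuous_on_subset[OF sample_matrix_continuous subset_UNIV] K(1))
  then have meas: "sample_matrix ` K \<in> sets (Pi\<^sub>M UNIV (\<lambda>_. borel))"
    unfolding sets_PiM_equal_borel by (intro borel_closed compact_imp_closed)
  have "measure ?P K \<le> measure ?P (sample_matrix -` sample_matrix ` K \<inter> space ?P)"
    using K(2) sets.sets_into_space
    by (intro P.finite_measure_mono measurable_sets[OF sample_matrix_measurable[OF D] meas]) auto
  also have "\<dots> = measure (matrix_law \<nu>) (sample_matrix ` K)"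
    unfolding matrix_law_def by (rule measure_distr[OF sample_matrix_measurable[OF D] meas, symmetric])
  finally have "1 / 2 < measure (matrix_law \<nu>) (sample_matrix ` K)" using K(3) by linarith
  then show ?thesis using that cpt K(4) by blast
qed

lemma exists_equal_equidistributed_samples:
  fixes \<nu> :: "('a::metric_space \<times> real) measure" and \<nu>' :: "('b::metric_space \<times> real) measure"
  assumes D: "long_dendron T \<nu>" and D': "long_dendron T' \<nu>'"
    and eq: "matrix_law \<nu> = matrix_law \<nu>'"
  obtains x x' where "equidistributed \<nu> x" "equidistributed \<nu>' x'" "sample_matrix x = sample_matrix x'"
proof -
  obtain K where K: "compact (sample_matrix ` K)" "1 / 2 < measure (matrix_law \<nu>) (sample_matrix ` K)"
    "\<And>x. x \<in> K \<Longrightarrow> equidistributed \<nu> x"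
    using compact_matrices_of_equidistributed_samples[OF D] by metis
  obtain K' where K': "compact (sample_matrix ` K')" "1 / 2 < measure (matrix_law \<nu>') (sample_matrix ` K')"
    "\<And>x. x \<in> K' \<Longrightarrow> equidistributed \<nu>' x"
    using compact_matrices_of_equidistributed_samples[OF D'] by metis
  interpret L: prob_space "matrix_law \<nu>" by (rule prob_space_matrix_law[OF D])
  have sets: "C \<in> L.events" if "compact C" for C
    using that by (auto simp: matrix_law_def sets_PiM_equal_borel intro: borel_closed compact_imp_closed)
  have "sample_matrix ` K \<inter> sample_matrix ` K' \<noteq> {}"
  proof
    assume "sample_matrix ` K \<inter> sample_matrix ` K' = {}"
    then have "L.prob (sample_matrix ` K \<union> sample_matrix ` K') =
        L.prob (sample_matrix ` K) + L.prob (sample_matrix ` K')"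
      by (intro L.finite_measure_Union sets K(1) K'(1))
    with K(2) K'(2) L.prob_le_1[of "sample_matrix ` K \<union> sample_matrix ` K'"] show False
      by (simp add: eq)
  qed
  then obtain x x' where "x \<in> K" "x' \<in> K'" "sample_matrix x = sample_matrix x'" by blast
  then show ?thesis using that K(3) K'(3) by blast
qed

subsection \<open>Transfer of the measure\<close>

text \<open>A branch corresponds to an open set of measure \<open>p > 0\<close>, which is hit with
  frequency at least \<open>p / 2\<close> at all late sampling times. With finitely many visits the
  frequency would tend to 0.\<close>

lemma equidistributed_branch_recurrent:
  assumes D: "long_dendron T \<nu>" and x: "equidistributed \<nu> x"
  shows "branch_recurrent T (fst \<circ> x)"
  unfolding branch_recurrent_def
proof (intro conjI allI impI)
  show "range (fst \<circ> x) \<subseteq> T"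
    using x long_dendron_sets(2)[OF D] by (auto simp: equidistributed_def image_subset_iff mem_Times_iff)
  fix B assume B: "tree_branch T B"
  then obtain G where G: "open G" "B = T \<inter> G"
    using tree_branch_openin[OF long_dendron_sets(3)[OF D]] by metis
  have GU: "open (G \<times> UNIV)" "(G \<times> UNIV) \<inter> space \<nu> = B \<times> {0..}"
    using G long_dendron_sets(2)[OF D] by (auto intro: open_Times)
  define p where "p = measure \<nu> (B \<times> {0..})"
  have "p > 0" using long_dendron_branch(2)[OF D B] by (simp add: p_def)
  obtain N where N: "\<And>m. m \<ge> N \<Longrightarrow> p - p / 2 \<le> hit_frequency (64 ^ m) x (G \<times> UNIV)"
    using x GU \<open>p > 0\<close> half_gt_zero[of p] unfolding equidistributed_def p_def by metis
  show "infinite {i. (fst \<circ> x) i \<in> B}"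
  proof
    assume fin: "finite {i. (fst \<circ> x) i \<in> B}"
    define c where "c = card {i. (fst \<circ> x) i \<in> B}"
    obtain n where n: "2 * c / p < 64 ^ n" using real_arch_pow[of 64 "2 * c / p"] by auto
    define m where "m = max N n"
    have "fst (x i) \<in> T" for i using x long_dendron_sets(2)[OF D] by (auto simp: equidistributed_def image_subset_iff mem_Times_iff)
    then have "card {i. i < 64 ^ m \<and> x i \<in> G \<times> UNIV} \<le> c"
      unfolding c_def using G(2) by (intro card_mono[OF fin]) (auto simp: mem_Times_iff)
    then have "hit_frequency (64 ^ m) x (G \<times> UNIV) \<le> c / 64 ^ m"
      unfolding hit_frequency_def by (simp add: divide_right_mono)
    moreover have "p - p / 2 \<le> hit_frequency (64 ^ m) x (G \<times> UNIV)"
      by (rule N) (simp add: m_def)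
    ultimately have "p / 2 \<le> c / 64 ^ m" by linarith
    then have "p * 64 ^ m \<le> 2 * c" by (simp add: field_simps)
    moreover have "p * 64 ^ n \<le> p * 64 ^ m" using \<open>p > 0\<close> by (simp add: m_def)
    moreover have "2 * c < p * 64 ^ n" using n \<open>p > 0\<close> by (simp add: divide_less_eq mult.commute)
    ultimately show False by linarith
  qed
qed

lemma hit_frequency_disjoint_le_1:
  assumes "\<And>i. x i \<in> G \<Longrightarrow> y i \<notin> H" and "n > 0"
  shows "hit_frequency n x G + hit_frequency n y H \<le> 1"
proof -
  have "card {i. i < n \<and> x i \<in> G} + card {i. i < n \<and> y i \<in> H} =
      card ({i. i < n \<and> x i \<in> G} \<union> {i. i < n \<and> y i \<in> H})"
    using assms(1) by (intro card_Un_disjoint[symmetric]) auto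
  also have "\<dots> \<le> card {..<n}" by (intro card_mono) auto
  finally have "real (card {i. i < n \<and> x i \<in> G} + card {i. i < n \<and> y i \<in> H}) \<le> real n" by simp
  with \<open>n > 0\<close> show ?thesis
    by (simp add: hit_frequency_def add_divide_distrib[symmetric])
qed

text \<open>Equidistribution bounds frequencies from below on open sets only, so it is applied to
  \<open>G\<close> and to the complement of \<open>F\<close>. No index counts for both, so at a
  common late time the two frequencies add up to at most 1.\<close>

lemma equidistributed_measure_le:
  assumes M: "prob_space M'" and x: "equidistributed M x" and y: "equidistributed M' y"
    and G: "open G" and F: "closed F" "F \<inter> space M' \<in> sets M'" and imp: "\<And>i. x i \<in> G \<Longrightarrow> y i \<in> F"
  shows "measure M (G \<inter> space M) \<le> measure M' (F \<inter> space M')"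
proof (rule field_le_epsilon)
  interpret M': prob_space M' by fact
  fix e :: real assume "e > 0"
  then have e: "e / 2 > 0" by simp
  obtain N where N: "\<And>m. m \<ge> N \<Longrightarrow> measure M (G \<inter> space M) - e / 2 \<le> hit_frequency (64 ^ m) x G"
    using x G e unfolding equidistributed_def by metis
  obtain N' where N': "\<And>m. m \<ge> N' \<Longrightarrow> measure M' (- F \<inter> space M') - e / 2 \<le> hit_frequency (64 ^ m) y (- F)"
    using y F(1) e unfolding equidistributed_def by (metis open_Compl)
  have "measure M' (- F \<inter> space M') = 1 - measure M' (F \<inter> space M')"
    using M'.prob_compl[OF F(2)] by (simp add: Diff_Int_distrib2 Diff_eq Int_commute Int_Un_distrib)
  moreover have "hit_frequency (64 ^ max N N') x G + hit_frequency (64 ^ max N N') y (- F) \<le> 1"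
    by (rule hit_frequency_disjoint_le_1) (use imp in auto)
  ultimately show "measure M (G \<inter> space M) \<le> measure M' (F \<inter> space M') + e"
    using N[of "max N N'"] N'[of "max N N'"] by simp
qed

text \<open>Complements turn the bound on closed sets into the reverse bound on open sets.
  Exhausting an open set by closed sets gives the other inequality, and traces of open sets form an
  intersection-stable generator.\<close>

lemma prob_space_eqI_closed:
  fixes M N :: "'a::metric_space measure"
  assumes M: "prob_space M" and N: "prob_space N" and sets_N: "sets N = sets (restrict_space borel (space N))"
    and sets_M: "sets M = sets N" and closed: "closed (space N)"
    and le: "\<And>F. closed F \<Longrightarrow> measure M (F \<inter> space N) \<le> measure N (F \<inter> space N)"
  shows "M = N"
proof -
  interpret M: prob_space M by fact
  interpret N: prob_space N by fact
  have space_M: "space M = space N" using sets_M by (rule sets_eq_imp_space_eq)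
  have sets: "B \<inter> space N \<in> sets N" if "B \<in> sets borel" for B
    unfolding sets_N sets_restrict_space using that by (auto simp: Int_commute)
  have eq: "measure M (G \<inter> space N) = measure N (G \<inter> space N)" if G: "open G" for G
  proof (rule antisym)
    have "measure M (- G \<inter> space N) \<le> measure N (- G \<inter> space N)"
      using G by (intro le) auto
    moreover have "- G \<inter> space N = space N - G \<inter> space N" by auto
    ultimately show "measure N (G \<inter> space N) \<le> measure M (G \<inter> space N)"
      using N.prob_compl[OF sets[OF borel_open[OF G]]] M.prob_compl[of "G \<inter> space N"]
        sets[OF borel_open[OF G]] by (simp add: sets_M space_M)
    show "measure M (G \<inter> space N) \<le> measure N (G \<inter> space N)"
    \<comment> \<open>The exhaustion uses the distance to the complement, which must be nonempty for
      \<open>infdist\<close> to be meaningful.\<close>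
    proof (cases "G = UNIV")
      case True
      then show ?thesis using le[of UNIV] by simp
    next
      case False
      define F where "F n = {y. 1 / real (Suc n) \<le> infdist y (- G)}" for n
      have F: "closed (F n)" for n
        unfolding F_def by (intro closed_Collect_le continuous_intros)
      have FG: "(\<Union>n. F n) = G"
      proof (rule set_eqI)
        fix y
        have "y \<in> G \<longleftrightarrow> 0 < infdist y (- G)"
          using infdist_pos_not_in_closed[of "- G" y] infdist_zero[of y "- G"] G False
          by (cases "y \<in> G") auto
        also have "\<dots> \<longleftrightarrow> (\<exists>n. 1 / real (Suc n) \<le> infdist y (- G))"
        proof
          assume "0 < infdist y (- G)"
          then obtain n where "1 / real (Suc n) < infdist y (- G)" by (rule nat_approx_posE)
          then show "\<exists>n. 1 / real (Suc n) \<le> infdist y (- G)" using less_imp_le by blast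
        next
          assume "\<exists>n. 1 / real (Suc n) \<le> infdist y (- G)"
          then obtain n where "1 / real (Suc n) \<le> infdist y (- G)" ..
          moreover have "0 < 1 / real (Suc n)" by simp
          ultimately show "0 < infdist y (- G)" by linarith
        qed
        finally have "y \<in> G \<longleftrightarrow> (\<exists>n. y \<in> F n)" unfolding F_def mem_Collect_eq .
        then show "y \<in> (\<Union>n. F n) \<longleftrightarrow> y \<in> G" by blast
      qed
      have incseq: "incseq (\<lambda>n. F n \<inter> space N)"
      proof (rule incseq_SucI)
        fix n
        have "1 / real (Suc (Suc n)) \<le> 1 / real (Suc n)" by (simp add: field_simps)
        then show "F n \<inter> space N \<subseteq> F (Suc n) \<inter> space N" unfolding F_def by auto
      qed
      have "(\<lambda>n. measure M (F n \<inter> space N)) \<longlonglongrightarrow> measure M (\<Union>n. F n \<inter> space N)"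
        by (rule M.finite_Lim_measure_incseq[OF _ incseq]) (use sets[OF borel_closed[OF F]] in \<open>auto simp: sets_M\<close>)
      moreover have "(\<Union>n. F n \<inter> space N) = G \<inter> space N" using FG by auto
      ultimately have lim: "(\<lambda>n. measure M (F n \<inter> space N)) \<longlonglongrightarrow> measure M (G \<inter> space N)" by simp
      have "measure M (F n \<inter> space N) \<le> measure N (G \<inter> space N)" for n
      proof -
        have "measure N (F n \<inter> space N) \<le> measure N (G \<inter> space N)"
          using FG by (intro N.finite_measure_mono sets borel_open G) auto
        with le[OF F[of n]] show ?thesis by linarith
      qed
      then show ?thesis by (intro LIMSEQ_le_const2[OF lim]) auto
    qed
  qed
  define E where "E = (\<inter>) (space N) ` {G. open G}"
  have borel_sets: "sets (borel :: 'a measure) = sigma_sets UNIV {G. open G}"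
    by (simp add: borel_def)
  have "sets N = (\<inter>) (space N) ` sets borel"
    using sets_N by (simp only: sets_restrict_space)
  also have "\<dots> = sigma_sets (space N) E"
    unfolding E_def borel_sets
    by (rule sigma_sets_Int) (use borel_closed[OF closed] in \<open>auto simp: borel_sets\<close>)
  finally have gen: "sets N = sigma_sets (space N) E" .
  have E: "X \<in> E \<Longrightarrow> \<exists>G. open G \<and> X = G \<inter> space N" for X by (auto simp: E_def)
  show "M = N"
  proof (rule measure_eqI_generator_eq[where A = "\<lambda>_. space N"])
    show "Int_stable E"
    proof (rule Int_stableI)
      fix a b assume ab: "a \<in> E" "b \<in> E"
      obtain G where "open G" "a = G \<inter> space N" using E[OF ab(1)] by blast
      moreover obtain H where "open H" "b = H \<inter> space N" using E[OF ab(2)] by blast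
      ultimately have "open (G \<inter> H)" "a \<inter> b = space N \<inter> (G \<inter> H)" by auto
      then show "a \<inter> b \<in> E" unfolding E_def by blast
    qed
    show "emeasure M X = emeasure N X" if "X \<in> E" for X
      using E[OF that] eq by (auto simp: M.emeasure_eq_measure N.emeasure_eq_measure)
    show "range (\<lambda>_::nat. space N) \<subseteq> E" unfolding E_def by (auto intro!: image_eqI[of _ _ UNIV])
    show "emeasure M (space N) \<noteq> \<infinity>" for i :: nat by simp
    show "E \<subseteq> Pow (space N)" by (auto simp: E_def)
    show "sets N = sigma_sets (space N) E" by (rule gen)
    then show "sets M = sigma_sets (space N) E" by (simp only: sets_M)
  qed simp
qed

text \<open>A closed \<open>F\<close> is enclosed in open neighbourhoods \<open>G n\<close> and
  closed neighbourhoods \<open>C n\<close>. Whenever \<open>h (x i)\<close> is in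
  \<open>G n\<close>, \<open>y i\<close> is in \<open>C n\<close>, so comparing frequencies bounds
  the image measure of \<open>F\<close> by the measure of \<open>C n\<close>, and \<open>C n\<close>
  shrinks to \<open>F\<close>.\<close>

lemma equidistributed_distr:
  fixes M :: "'a::metric_space measure" and N :: "'b::metric_space measure"
  assumes M: "prob_space M" and sets_M: "sets M = sets (restrict_space borel (space M))"
    and N: "prob_space N" and sets_N: "sets N = sets (restrict_space borel (space N))"
    and closed: "closed (space N)"
    and x: "equidistributed M x" and y: "equidistributed N y"
    and h: "continuous_on (space M) h" "h ` space M \<subseteq> space N" "\<And>i. h (x i) = y i"
  shows "h \<in> measurable M N" "distr M N h = N"
proof -
  interpret M: prob_space M by fact
  interpret N: prob_space N by fact
  have sets: "B \<inter> space N \<in> sets N" if "B \<in> sets borel" for B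
    unfolding sets_N sets_restrict_space using that by (auto simp: Int_commute)
  show meas: "h \<in> measurable M N"
    unfolding measurable_cong_sets[OF sets_M sets_N]
    using h by (intro measurable_restrict_space2 borel_measurable_continuous_on_restrict)
      (auto simp: space_restrict_space)
  show "distr M N h = N"
  proof (rule prob_space_eqI_closed[OF M.prob_space_distr[OF meas] N sets_N _ closed])
    fix F :: "'b set" assume F: "closed F"
    show "measure (distr M N h) (F \<inter> space N) \<le> measure N (F \<inter> space N)"
    proof (cases "F = {}")
      case False
      define C where "C n = {y. infdist y F \<le> 1 / real (Suc n)}" for n
      define G where "G n = {y. infdist y F < 1 / real (Suc n)}" for n
      have C: "closed (C n)" and G: "open (G n)" for n
        unfolding C_def G_def by (intro closed_Collect_le open_Collect_less continuous_intros)+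
      have le: "measure (distr M N h) (F \<inter> space N) \<le> measure N (C n \<inter> space N)" for n
      proof -
        \<comment> \<open>\<open>h\<close> is continuous only on the space, so the preimage of
          \<open>G n\<close> is the trace of an open set \<open>O'\<close>, to which
          equidistribution applies.\<close>
        obtain O' where O': "open O'" "O' \<inter> space M = h -` G n \<inter> space M"
          using h(1) G[of n] unfolding continuous_on_open_invariant by blast
        have "measure (distr M N h) (F \<inter> space N) = measure M (h -` (F \<inter> space N) \<inter> space M)"
          by (rule measure_distr[OF meas sets[OF borel_closed[OF F]]])
        also have "\<dots> \<le> measure M (O' \<inter> space M)"
        proof (rule M.finite_measure_mono)
          show "O' \<inter> space M \<in> M.events"
            using O'(1) unfolding sets_M sets_restrict_space by (auto simp: Int_commute)
          have "F \<subseteq> G n" by (auto simp: G_def)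
          then show "h -` (F \<inter> space N) \<inter> space M \<subseteq> O' \<inter> space M" using O'(2) by blast
        qed
        also have "\<dots> \<le> measure N (C n \<inter> space N)"
        proof (rule equidistributed_measure_le[OF N x y O'(1) C sets[OF borel_closed[OF C]]])
          fix i assume "x i \<in> O'"
          moreover have "x i \<in> space M" using x by (auto simp: equidistributed_def)
          ultimately have "h (x i) \<in> G n" using O'(2) by blast
          then show "y i \<in> C n" unfolding h(3) by (simp add: G_def C_def)
        qed
        finally show ?thesis .
      qed
      have "(\<lambda>n. measure N (C n \<inter> space N)) \<longlonglongrightarrow> measure N (\<Inter>n. C n \<inter> space N)"
      proof (rule N.finite_Lim_measure_decseq)
        show "range (\<lambda>n. C n \<inter> space N) \<subseteq> N.events" using sets[OF borel_closed[OF C]] by auto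
        show "decseq (\<lambda>n. C n \<inter> space N)"
        proof (rule decseq_SucI)
          fix n
          have "1 / real (Suc (Suc n)) \<le> 1 / real (Suc n)" by (simp add: field_simps)
          then show "C (Suc n) \<inter> space N \<subseteq> C n \<inter> space N" unfolding C_def by auto
        qed
      qed
      moreover have "(\<Inter>n. C n \<inter> space N) = F \<inter> space N"
      proof -
        have "y \<in> F" if "\<And>n. infdist y F \<le> 1 / real (Suc n)" for y
        proof (rule ccontr)
          assume "y \<notin> F"
          then have "infdist y F > 0" using infdist_pos_not_in_closed[OF F False] by simp
          then obtain n where "1 / real (Suc n) < infdist y F" by (rule nat_approx_posE)
          with that[of n] show False by simp
        qed
        then show ?thesis by (auto simp: C_def)
      qed
      ultimately have "(\<lambda>n. measure N (C n \<inter> space N)) \<longlonglongrightarrow> measure N (F \<inter> space N)" by simp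
      then show ?thesis by (rule LIMSEQ_le_const) (use le in auto)
    qed simp
  qed simp
qed

text \<open>Two equidistributed samples with a common matrix have equal heights, by comparison in
  both directions, and hence equal distances between base points. The resulting isometry, extended
  by the identity on heights, carries one sample to the other and therefore one measure to the
  other.\<close>

lemma long_dendron_isomorphic:
  assumes D: "long_dendron T \<nu>" and D': "long_dendron T' \<nu>'"
    and eq: "\<And>r. r \<ge> 1 \<Longrightarrow> dendron_sampling r \<nu> = dendron_sampling r \<nu>'"
  shows "dendron_isomorphic T \<nu> T' \<nu>'"
proof -
  note sp = long_dendron_sets[OF D] and sp' = long_dendron_sets[OF D']
  obtain x x' where x: "equidistributed \<nu> x" and x': "equidistributed \<nu>' x'"
    and same: "sample_matrix x = sample_matrix x'"
    using exists_equal_equidistributed_samples[OF D D' matrix_law_eqI[OF D D' eq]] by metis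
  note rec = equidistributed_branch_recurrent[OF D x] and rec' = equidistributed_branch_recurrent[OF D' x']
  have dd: "dist (fst (x' i)) (fst (x' j)) + snd (x' i) + snd (x' j) =
      dist (fst (x i)) (fst (x j)) + snd (x i) + snd (x j)" if "i \<noteq> j" for i j
    using fun_cong[OF same, of "(i, j)"] that by (simp add: sample_matrix_def dendron_dist_def)
  have heights: "snd (x' i) = snd (x i)" for i
  proof (rule antisym)
    show "snd (x' i) \<le> snd (x i)"
      by (rule branch_recurrent_heights[OF sp(3) rec, where u' = "fst \<circ> x'"]) (simp add: dd)
    show "snd (x i) \<le> snd (x' i)"
      by (rule branch_recurrent_heights[OF sp'(3) rec', where u' = "fst \<circ> x"]) (simp add: dd)
  qed
  have "dist ((fst \<circ> x') i) ((fst \<circ> x') j) = dist ((fst \<circ> x) i) ((fst \<circ> x) j)" for i j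
    using dd[of i j] heights by (cases "i = j") auto
  then obtain f where f: "bij_betw f T T'" "\<And>p q. p \<in> T \<Longrightarrow> q \<in> T \<Longrightarrow> dist (f p) (f q) = dist p q"
    "\<And>i. f ((fst \<circ> x) i) = (fst \<circ> x') i"
    using branch_recurrent_isometry[OF sp(3) rec sp'(3) rec'] by metis
  define h where "h = (\<lambda>(p, a :: real). (f p, a))"
  have cont_f: "continuous_on T f"
    unfolding continuous_on_iff
  proof (intro ballI allI impI)
    fix p and e :: real assume "p \<in> T" "0 < e"
    then show "\<exists>d>0. \<forall>q\<in>T. dist q p < d \<longrightarrow> dist (f q) (f p) < e"
      by (intro exI[of _ e]) (simp add: f(2))
  qed
  have "continuous_on (T \<times> {0..}) (\<lambda>z :: 'a \<times> real. f (fst z))"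
    by (rule continuous_on_compose2[OF cont_f continuous_on_fst[OF continuous_on_id]]) auto
  then have cont: "continuous_on (T \<times> {0..}) h"
    unfolding h_def case_prod_beta by (intro continuous_on_Pair continuous_on_snd continuous_on_id)
  have "complete T'" using sp'(3) by (simp add: real_tree_def)
  then have closed: "closed (space \<nu>')"
    unfolding sp'(2) by (intro closed_Times) (auto intro: complete_imp_closed)
  have "h \<in> measurable \<nu> \<nu>'" "distr \<nu> \<nu>' h = \<nu>'"
  proof -
    have hx: "h (x i) = x' i" for i
      using f(3)[of i] heights[of i] by (simp add: h_def case_prod_beta prod_eq_iff)
    have him: "h ` space \<nu> \<subseteq> space \<nu>'"
      using f(1) by (auto simp: h_def sp(2) sp'(2) bij_betw_def)
    have sets: "sets \<nu> = sets (restrict_space borel (space \<nu>))"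
      "sets \<nu>' = sets (restrict_space borel (space \<nu>'))"
      using sp sp' by simp_all
    have cont': "continuous_on (space \<nu>) h" using cont sp(2) by simp
    show "h \<in> measurable \<nu> \<nu>'" "distr \<nu> \<nu>' h = \<nu>'"
      by (rule equidistributed_distr[OF sp(4) sets(1) sp'(4) sets(2) closed x x' cont' him hx])+
  qed
  with f show ?thesis
    unfolding dendron_isomorphic_def h_def by blast
qed

text \<open>Uniqueness of weak limits identifies the sampling measures of the two dendrons, so the
  statement on limits of trees reduces to the one on long dendrons.\<close>

theorem theorem3:
  shows "(\<forall>(V :: nat \<Rightarrow> 'v set) (E :: nat \<Rightarrow> 'v rel)
            (T :: 'a::metric_space set) \<nu> (T' :: 'b::metric_space set) \<nu>'.
            (\<forall>n. nontrivial_finite_tree (V n) (E n)) \<and> dendron T \<nu> \<and> dendron T' \<nu>' \<and>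
            (\<forall>r\<ge>1. weakly_converges (matrix_topology r)
                (\<lambda>n. tree_sampling r (V n) (E n)) (dendron_sampling r \<nu>)) \<and>
            (\<forall>r\<ge>1. weakly_converges (matrix_topology r)
                (\<lambda>n. tree_sampling r (V n) (E n)) (dendron_sampling r \<nu>'))
            \<longrightarrow> dendron_isomorphic T \<nu> T' \<nu>')
       \<and> (\<forall>(T :: 'a set) \<nu> (T' :: 'b set) \<nu>'.
            long_dendron T \<nu> \<and> long_dendron T' \<nu>' \<and>
            (\<forall>r\<ge>1. dendron_sampling r \<nu> = dendron_sampling r \<nu>')
            \<longrightarrow> dendron_isomorphic T \<nu> T' \<nu>')"
proof (rule conjI; intro allI impI; elim conjE)
  fix V :: "nat \<Rightarrow> 'v set" and E :: "nat \<Rightarrow> 'v rel"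
    and T :: "'a set" and \<nu> and T' :: "'b set" and \<nu>'
  assume "dendron T \<nu>" "dendron T' \<nu>'"
    and lim: "\<forall>r\<ge>1. weakly_converges (matrix_topology r)
      (\<lambda>n. tree_sampling r (V n) (E n)) (dendron_sampling r \<nu>)"
    "\<forall>r\<ge>1. weakly_converges (matrix_topology r)
      (\<lambda>n. tree_sampling r (V n) (E n)) (dendron_sampling r \<nu>')"
  then have D: "long_dendron T \<nu>" and D': "long_dendron T' \<nu>'"
    by (auto simp: dendron_def)
  have fin: "finite_measure (dendron_sampling r \<nu>)" "finite_measure (dendron_sampling r \<nu>')" for r
    using prob_space_dendron_sampling[OF D] prob_space_dendron_sampling[OF D']
    by (auto simp: prob_space_def)
  have "dendron_sampling r \<nu> = dendron_sampling r \<nu>'" if "r \<ge> 1" for r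
    by (rule weak_limit_unique[OF lim(1)[rule_format, OF that] lim(2)[rule_format, OF that]
          fin(1) sets_dendron_sampling fin(2) sets_dendron_sampling])
  then show "dendron_isomorphic T \<nu> T' \<nu>'"
    by (rule long_dendron_isomorphic[OF D D'])
qed (rule long_dendron_isomorphic; blast)

end
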